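(* Every vertical plane $\{(x,y,t)\in\mathbb H^1\mid ax+by=\gamma\}$, with $a,b,\gamma\in\mathbb R$ and $(a,b)\ne(0,0)$, is stable.
   Context: $\mathbb H^1$ is $\mathbb R^3$ with the group law $(x,y,t)\circ(x',y',t')=(x+x',y+y',t+t'+\tfrac12(xy'-x'y))$. Left-invariant vector fields: $X_1=\partial_x-\tfrac y2\partial_t$, $X_2=\partial_y+\tfrac x2\partial_t$, $T=\partial_t$. The characteristic locus of a $C^2$ surface $\mathcal S$ is $\Sigma(\mathcal S)=\{g\in\mathcal S\mid T_g\mathcal S=\mathrm{span}\{X_1(g),X_2(g)\}\}$. If $\Sigma(\mathcal S)=\varnothing$, for a local $C^2$ defining function $\phi$ put $W=\sqrt{(X_1\phi)^2+(X_2\phi)^2}$; the $H$-mean curvature is $\mathcal H=X_1(X_1\phi/W)+X_2(X_2\phi/W)$ restricted to $\mathcal S$, and $\mathcal S$ is $H$-minimal if $\mathcal H\equiv0$. The $H$-perimeter measure on $\mathcal S$ is $d\sigma_H=\frac{W}{|\nabla_e\phi|}\,d\mathcal H^2$, with $\nabla_e$ the Euclidean gradient and $\mathcal H^2$ the Euclidean surface measure, and $P_H(\mathcal S)=\sigma_H(\mathcal S)$. For $\mathcal X=aX_1+bX_2+kT$ with $a,b,k\in C^2_0(\mathcal S)$ (compactly supported), let $\mathcal S^\lambda=\mathcal S+\lambda\mathcal X$, i.e. each $g\in\mathcal S$ is moved to $g+\lambda\mathcal X(g)$; the first and second variations are the first and second derivatives of $\lambda\mapsto P_H(\mathcal S^\lambda)$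 at $\lambda=0$ (only the perimeter of a compact portion containing the support of $\mathcal X$ matters), the second one being denoted $\mathcal V^H_{II}(\mathcal S;\mathcal X)$. A $C^2$ surface with empty characteristic locus is stable if it is stationary (all first variations vanish; equivalently, it is $H$-minimal) and $\mathcal V^H_{II}(\mathcal S;\mathcal X)\ge0$ for every such $\mathcal X$. *)

theory Defs
  imports "HOL-Analysis.Analysis"
begin

section \<open>Functions of class C1 and C2\<close>

definition C1_on ::
  "'a::real_normed_vector set \<Rightarrow> ('a \<Rightarrow> 'b::real_normed_vector) \<Rightarrow> bool" where
  "C1_on U f \<longleftrightarrow>
     (\<exists>f' :: 'a \<Rightarrow> 'a \<Rightarrow>\<^sub>L 'b.
        (\<forall>x\<in>U. (f has_derivative blinfun_apply (f' x)) (at x)) \<and> continuous_on U f')"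

definition C2_on ::
  "'a::real_normed_vector set \<Rightarrow> ('a \<Rightarrow> 'b::real_normed_vector) \<Rightarrow> bool" where
  "C2_on U f \<longleftrightarrow>
     (\<exists>f' :: 'a \<Rightarrow> 'a \<Rightarrow>\<^sub>L 'b.
        (\<forall>x\<in>U. (f has_derivative blinfun_apply (f' x)) (at x)) \<and> C1_on U f')"

definition euclid_grad :: "(real^3 \<Rightarrow> real) \<Rightarrow> real^3 \<Rightarrow> real^3" where
  "euclid_grad \<phi> g = (\<chi> i. frechet_derivative \<phi> (at g) (axis i 1))"


section \<open>The Heisenberg group and its left-invariant vector fields\<close>

text \<open>The point (x, y, t) of the first Heisenberg group is the vector of \<^typ>\<open>real^3\<close> with
  components x, y, t. The fields below are left-invariant for the group law
  (x, y, t) (x', y', t') = (x + x', y + y', t + t' + (x y' - x' y) / 2);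
  each is given by its coefficients in the Cartesian coordinates.\<close>

definition X1 :: "real^3 \<Rightarrow> real^3" where
  "X1 g = vector [1, 0, - (g$2) / 2]"

definition X2 :: "real^3 \<Rightarrow> real^3" where
  "X2 g = vector [0, 1, g$1 / 2]"

definition T :: "real^3 \<Rightarrow> real^3" where
  "T g = vector [0, 0, 1]"

definition apply_field :: "(real^3 \<Rightarrow> real^3) \<Rightarrow> (real^3 \<Rightarrow> real) \<Rightarrow> real^3 \<Rightarrow> real" where
  "apply_field V \<phi> g = frechet_derivative \<phi> (at g) (V g)"


section \<open>Surfaces of class C2 and their characteristic locus\<close>

definition defining_function :: "(real^3) set \<Rightarrow> (real^3) set \<Rightarrow> (real^3 \<Rightarrow> real) \<Rightarrow> bool" where
  "defining_function S U \<phi> \<longleftrightarrow>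
     open U \<and> C2_on U \<phi> \<and> (\<forall>g\<in>U. euclid_grad \<phi> g \<noteq> 0) \<and> S \<inter> U = {g \<in> U. \<phi> g = 0}"

definition C2_surface :: "(real^3) set \<Rightarrow> bool" where
  "C2_surface S \<longleftrightarrow> (\<forall>g\<in>S. \<exists>U \<phi>. g \<in> U \<and> defining_function S U \<phi>)"

definition tangent_space :: "(real^3) set \<Rightarrow> real^3 \<Rightarrow> (real^3) set" where
  "tangent_space S g =
     {v. \<exists>c \<epsilon>. \<epsilon> > 0 \<and> c C1_differentiable_on {-\<epsilon><..<\<epsilon>} \<and> (\<forall>s\<in>{-\<epsilon><..<\<epsilon>}. c s \<in> S) \<and>
          c 0 = g \<and> (c has_vector_derivative v) (at (0::real))}"

definition characteristic_locus :: "(real^3) set \<Rightarrow> (real^3) set" where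
  "characteristic_locus S = {g \<in> S. tangent_space S g = span {X1 g, X2 g}}"


section \<open>Euclidean surface measure\<close>

definition area_element :: "(real^2 \<Rightarrow> real^3) \<Rightarrow> real^2 \<Rightarrow> real" where
  "area_element \<psi> u =
     norm (cross3 (frechet_derivative \<psi> (at u) (axis 1 1)) (frechet_derivative \<psi> (at u) (axis 2 1)))"

definition local_parametrization ::
  "(real^3) set \<Rightarrow> (real^2) set \<Rightarrow> (real^2 \<Rightarrow> real^3) \<Rightarrow> bool" where
  "local_parametrization S U \<psi> \<longleftrightarrow>
     open U \<and> C1_on U \<psi> \<and> (\<forall>u\<in>U. area_element \<psi> u \<noteq> 0) \<and>
     openin (top_of_set S) (\<psi> ` U) \<and> (\<exists>\<psi>'. homeomorphism U (\<psi> ` U) \<psi> \<psi>')"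

text \<open>The Euclidean surface measure (two-dimensional Hausdorff measure on the surface) is the
  unique Borel measure on \<open>S\<close> which every regular local parametrization computes by the area
  formula.\<close>

definition surface_measure :: "(real^3) set \<Rightarrow> (real^3) measure" where
  "surface_measure S =
     (THE \<mu>. sets \<mu> = sets (restrict_space borel S) \<and>
        (\<forall>U \<psi> B. local_parametrization S U \<psi> \<longrightarrow> B \<in> sets borel \<longrightarrow> B \<subseteq> U \<longrightarrow>
           emeasure \<mu> (\<psi> ` B) = (\<integral>\<^sup>+u\<in>B. ennreal (area_element \<psi> u) \<partial>lborel)))"


section \<open>Horizontal perimeter\<close>

definition W :: "(real^3 \<Rightarrow> real) \<Rightarrow> real^3 \<Rightarrow> real" where
  "W \<phi> g = sqrt ((apply_field X1 \<phi> g)\<^sup>2 + (apply_field X2 \<phi> g)\<^sup>2)"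

text \<open>The quotient does not depend on the local defining function, since the Euclidean gradients
  at \<open>g\<close> of any two of them are parallel.\<close>

definition H_perimeter_density :: "(real^3) set \<Rightarrow> real^3 \<Rightarrow> real" where
  "H_perimeter_density S g =
     (THE w. \<forall>U \<phi>. g \<in> U \<and> defining_function S U \<phi> \<longrightarrow> w = W \<phi> g / norm (euclid_grad \<phi> g))"

definition H_perimeter_measure :: "(real^3) set \<Rightarrow> (real^3) measure" where
  "H_perimeter_measure S = density (surface_measure S) (\<lambda>g. ennreal (H_perimeter_density S g))"


section \<open>Variations and stability\<close>

definition C2_function_on_surface :: "(real^3) set \<Rightarrow> (real^3 \<Rightarrow> real) \<Rightarrow> bool" where
  "C2_function_on_surface S f \<longleftrightarrow>
     (\<forall>g\<in>S. \<exists>U F. open U \<and> g \<in> U \<and> C2_on U F \<and> (\<forall>p\<in>S \<inter> U. F p = f p))"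

definition supp :: "(real^3) set \<Rightarrow> (real^3 \<Rightarrow> real) \<Rightarrow> (real^3) set" where
  "supp S f = S \<inter> closure {g \<in> S. f g \<noteq> 0}"

definition C2_compact_support :: "(real^3) set \<Rightarrow> (real^3 \<Rightarrow> real) \<Rightarrow> bool" where
  "C2_compact_support S f \<longleftrightarrow> C2_function_on_surface S f \<and> compact (supp S f)"

definition deform ::
  "(real^3 \<Rightarrow> real) \<Rightarrow> (real^3 \<Rightarrow> real) \<Rightarrow> (real^3 \<Rightarrow> real) \<Rightarrow> real \<Rightarrow> real^3 \<Rightarrow> real^3" where
  "deform a b k s g = g + s *\<^sub>R (a g *\<^sub>R X1 g + b g *\<^sub>R X2 g + k g *\<^sub>R T g)"

text \<open>The perimeter of the whole surface may be infinite. What is differentiated is the perimeter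
  of the deformation of a compact portion \<open>K\<close> of \<open>S\<close> containing the support of the
  variation, measured as a part of the deformed surface; the value of a variation is required to be
  the same for every such \<open>K\<close>.\<close>

definition perimeter_along ::
  "(real^3) set \<Rightarrow> (real^3 \<Rightarrow> real) \<Rightarrow> (real^3 \<Rightarrow> real) \<Rightarrow> (real^3 \<Rightarrow> real) \<Rightarrow> (real^3) set
     \<Rightarrow> real \<Rightarrow> real" where
  "perimeter_along S a b k K s =
     measure (H_perimeter_measure (deform a b k s ` S)) (deform a b k s ` K)"

definition compact_portion ::
  "(real^3) set \<Rightarrow> (real^3 \<Rightarrow> real) \<Rightarrow> (real^3 \<Rightarrow> real) \<Rightarrow> (real^3 \<Rightarrow> real) \<Rightarrow> (real^3) set
     \<Rightarrow> bool" where
  "compact_portion S a b k K \<longleftrightarrow>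
     compact K \<and> K \<subseteq> S \<and> supp S a \<union> supp S b \<union> supp S k \<subseteq> K"

text \<open>Relations rather than functions, so that the existence of the derivatives is part of
  every statement about variations.\<close>

definition has_first_variation ::
  "(real^3) set \<Rightarrow> (real^3 \<Rightarrow> real) \<Rightarrow> (real^3 \<Rightarrow> real) \<Rightarrow> (real^3 \<Rightarrow> real) \<Rightarrow> real \<Rightarrow> bool" where
  "has_first_variation S a b k v \<longleftrightarrow>
     (\<forall>K. compact_portion S a b k K \<longrightarrow>
        (perimeter_along S a b k K has_real_derivative v) (at 0))"

definition has_second_variation ::
  "(real^3) set \<Rightarrow> (real^3 \<Rightarrow> real) \<Rightarrow> (real^3 \<Rightarrow> real) \<Rightarrow> (real^3 \<Rightarrow> real) \<Rightarrow> real \<Rightarrow> bool" where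
  "has_second_variation S a b k v \<longleftrightarrow>
     (\<forall>K. compact_portion S a b k K \<longrightarrow>
        (\<exists>P'. (\<forall>\<^sub>F s in nhds 0. (perimeter_along S a b k K has_real_derivative P' s) (at s)) \<and>
              (P' has_real_derivative v) (at 0)))"

definition stationary :: "(real^3) set \<Rightarrow> bool" where
  "stationary S \<longleftrightarrow>
     (\<forall>a b k. C2_compact_support S a \<longrightarrow> C2_compact_support S b \<longrightarrow> C2_compact_support S k \<longrightarrow>
        has_first_variation S a b k 0)"

definition stable :: "(real^3) set \<Rightarrow> bool" where
  "stable S \<longleftrightarrow>
     C2_surface S \<and> characteristic_locus S = {} \<and> stationary S \<and>
     (\<forall>a b k. C2_compact_support S a \<longrightarrow> C2_compact_support S b \<longrightarrow> C2_compact_support S k \<longrightarrow>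
        (\<exists>v\<ge>0. has_second_variation S a b k v))"

definition vertical_plane :: "real \<Rightarrow> real \<Rightarrow> real \<Rightarrow> (real^3) set" where
  "vertical_plane a b \<gamma> = {g. a * g$1 + b * g$2 = \<gamma>}"

end

theory Submission
  imports Defs
begin

text \<open>Write \<open>n = (a, b, 0)\<close>, normalised to unit length, and let \<open>\<tau> = (- b, a, 0)\<close>. A deformation of
  the plane moves the point with coordinates \<open>w\<close> by \<open>s\<close> times \<open>f n + h \<tau> + m \<partial>\<^sub>t\<close>. For small
  \<open>s\<close> the image is a graph over the plane, so it has a global chart and a global defining
  function, and its horizontal perimeter is the integral of \<open>sqrt (A\<^sup>2 + B\<^sup>2)\<close>, where \<open>A\<close> and \<open>B\<close>
  are the components of the chart normal along \<open>a X1 + b X2\<close> and \<open>- b X1 + a X2\<close>. Both are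
  polynomials in \<open>s\<close>: \<open>A = 1 + s A1 + s\<^sup>2 A2 + \<dots>\<close> and \<open>B = s B1 + \<dots>\<close>. Here \<open>A1\<close> is a divergence and
  \<open>A2\<close> a sum of Jacobian determinants of compactly supported functions, so both integrate to zero.
  The first variation is therefore \<open>0\<close>, and the second one is the integral of \<open>B1\<^sup>2\<close>.\<close>

section \<open>Calculus of C1 and C2 functions\<close>

text \<open>The surface measure and the perimeter density are definite descriptions, quantified over
  all local parametrizations and all local defining functions. A perimeter formula therefore has to
  compare one global chart with every other parametrization, and its normal with every other
  gradient. This is why a chart comes with a C1 left inverse defined on the whole space: transition
  maps, immersivity and measurability all follow from it. Smallness of \<open>s\<close> is needed so
  that the tangential displacement \<open>(h, m)\<close> stays a C2 diffeomorphism of the coordinate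
  plane, and again so that \<open>A\<close> stays positive and the square root differentiable.
  Compact portions of the plane are arbitrary, but off the support the integrand is constantly 1, so
  the portion changes the perimeter only by an additive constant. The tangential fields stay in the
  computation: they occur in \<open>A1\<close> and \<open>A2\<close> and drop out only after
  integration, while \<open>B1\<close> contains the normal displacement \<open>f\<close>
  alone.\<close>

lemma C1_onI:
  fixes f :: "'a::euclidean_space \<Rightarrow> 'b::real_normed_vector"
  assumes "\<And>x. x \<in> U \<Longrightarrow> (f has_derivative f' x) (at x)"
    and "\<And>i. i \<in> Basis \<Longrightarrow> continuous_on U (\<lambda>x. f' x i)"
  shows "C1_on U f"
  unfolding C1_on_def
proof (intro exI conjI ballI)
  have bl: "blinfun_apply (Blinfun (f' x)) = f' x" if "x \<in> U" for x
    using assms(1)[OF that] has_derivative_bounded_linear bounded_linear_Blinfun_apply by blast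
  show "(f has_derivative blinfun_apply (Blinfun (f' x))) (at x)" if "x \<in> U" for x
    using assms(1) bl that by simp
  \<comment> \<open>The domain is finite-dimensional, so continuity in operator norm can be tested
    on basis vectors.\<close>
  have "continuous_on U (\<lambda>x. Blinfun (f' x) i)" if "i \<in> Basis" for i
    using assms(2)[OF that] by (rule continuous_on_eq) (simp add: bl)
  then show "continuous_on U (\<lambda>x. Blinfun (f' x))"
    by (intro continuous_blinfun_componentwiseI1 continuous_on_blinfun_componentwise) auto
qed

lemma C1_onE:
  assumes "C1_on U f"
  obtains f' where "\<And>x. x \<in> U \<Longrightarrow> (f has_derivative blinfun_apply (f' x)) (at x)"
    and "continuous_on U f'"
  using assms unfolding C1_on_def by blast

lemma C1_on_imp_continuous_on: "C1_on U f \<Longrightarrow> continuous_on U f"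
  by (metis C1_onE continuous_at_imp_continuous_on has_derivative_continuous)

lemma C1_on_const [simp]: "C1_on U (\<lambda>x. c)"
  unfolding C1_on_def by (intro exI[of _ "\<lambda>x. 0"]) (auto simp: zero_blinfun.rep_eq)

lemma C1_on_bounded_linear: "bounded_linear L \<Longrightarrow> C1_on U L"
  unfolding C1_on_def
  by (intro exI[of _ "\<lambda>x. Blinfun L"])
     (simp_all add: bounded_linear_Blinfun_apply bounded_linear_imp_has_derivative)

lemma C1_on_compose:
  assumes f: "C1_on U f" and g: "C1_on V g" and "f ` U \<subseteq> V"
  shows "C1_on U (\<lambda>x. g (f x))"
proof -
  obtain f' where f': "\<And>x. x \<in> U \<Longrightarrow> (f has_derivative blinfun_apply (f' x)) (at x)" "continuous_on U f'"
    using f by (rule C1_onE) blast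
  obtain g' where g': "\<And>x. x \<in> V \<Longrightarrow> (g has_derivative blinfun_apply (g' x)) (at x)" "continuous_on V g'"
    using g by (rule C1_onE) blast
  show ?thesis unfolding C1_on_def
  proof (intro exI conjI ballI)
    show "((\<lambda>x. g (f x)) has_derivative blinfun_apply (g' (f x) o\<^sub>L f' x)) (at x)" if "x \<in> U" for x
    proof -
      have "f x \<in> V" using that assms by auto
      from has_derivative_compose[OF f'(1)[OF that] g'(1)[OF this]] show ?thesis
        by (simp add: blinfun_compose.rep_eq o_def)
    qed
    show "continuous_on U (\<lambda>x. g' (f x) o\<^sub>L f' x)"
      by (intro continuous_intros f' continuous_on_compose2[OF g'(2)] C1_on_imp_continuous_on f assms)
  qed
qed

lemma C1_on_linear_compose: "bounded_linear L \<Longrightarrow> C1_on U f \<Longrightarrow> C1_on U (\<lambda>x. L (f x))"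
  by (rule C1_on_compose[where V=UNIV]) (auto simp: C1_on_bounded_linear)

lemma C1_on_add:
  assumes "C1_on U f" "C1_on U g"
  shows "C1_on U (\<lambda>x. f x + g x)"
proof -
  obtain f' where f': "\<And>x. x \<in> U \<Longrightarrow> (f has_derivative blinfun_apply (f' x)) (at x)" "continuous_on U f'"
    using assms(1) by (rule C1_onE) blast
  obtain g' where g': "\<And>x. x \<in> U \<Longrightarrow> (g has_derivative blinfun_apply (g' x)) (at x)" "continuous_on U g'"
    using assms(2) by (rule C1_onE) blast
  show ?thesis unfolding C1_on_def
    by (intro exI[of _ "\<lambda>x. f' x + g' x"])
      (auto intro!: continuous_intros f' g' simp: plus_blinfun.rep_eq has_derivative_add f'(1) g'(1))
qed

lemma C1_on_mult:
  fixes f g :: "'a::real_normed_vector \<Rightarrow> real"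
  assumes "C1_on U f" "C1_on U g"
  shows "C1_on U (\<lambda>x. f x * g x)"
proof -
  obtain f' where f': "\<And>x. x \<in> U \<Longrightarrow> (f has_derivative blinfun_apply (f' x)) (at x)" "continuous_on U f'"
    using assms(1) by (rule C1_onE) blast
  obtain g' where g': "\<And>x. x \<in> U \<Longrightarrow> (g has_derivative blinfun_apply (g' x)) (at x)" "continuous_on U g'"
    using assms(2) by (rule C1_onE) blast
  show ?thesis unfolding C1_on_def
  proof (intro exI conjI ballI)
    show "((\<lambda>x. f x * g x) has_derivative blinfun_apply (f x *\<^sub>R g' x + g x *\<^sub>R f' x)) (at x)" if "x \<in> U" for x
      using has_derivative_mult[OF f'(1)[OF that] g'(1)[OF that]]
      by (rule has_derivative_eq_rhs) (auto simp: blinfun.bilinear_simps)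
    show "continuous_on U (\<lambda>x. f x *\<^sub>R g' x + g x *\<^sub>R f' x)"
      by (intro continuous_intros f' g' C1_on_imp_continuous_on assms)
  qed
qed

lemma C1_on_inverse:
  fixes f :: "'a::real_normed_vector \<Rightarrow> real"
  assumes "C1_on U f" "\<And>x. x \<in> U \<Longrightarrow> f x \<noteq> 0"
  shows "C1_on U (\<lambda>x. inverse (f x))"
proof -
  obtain f' where f': "\<And>x. x \<in> U \<Longrightarrow> (f has_derivative blinfun_apply (f' x)) (at x)" "continuous_on U f'"
    using assms(1) by (rule C1_onE) blast
  show ?thesis unfolding C1_on_def
  proof (intro exI conjI ballI)
    show "((\<lambda>x. inverse (f x)) has_derivative blinfun_apply ((- (inverse (f x) * inverse (f x))) *\<^sub>R f' x)) (at x)"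
      if "x \<in> U" for x
      using Deriv.has_derivative_inverse[OF assms(2)[OF that] f'(1)[OF that]]
      by (rule has_derivative_eq_rhs) (auto simp: blinfun.bilinear_simps)
    show "continuous_on U (\<lambda>x. (- (inverse (f x) * inverse (f x))) *\<^sub>R f' x)"
      by (intro continuous_intros f' C1_on_imp_continuous_on assms(1)) (use assms(2) in auto)
  qed
qed

lemma C1_on_sum:
  assumes "\<And>i. i \<in> I \<Longrightarrow> C1_on U (f i)"
  shows "C1_on U (\<lambda>x. \<Sum>i\<in>I. f i x)"
  using assms by (induction I rule: infinite_finite_induct) (simp_all add: C1_on_add)

lemma C1_on_minus: "C1_on U f \<Longrightarrow> C1_on U (\<lambda>x. - f x)"
  by (rule C1_on_linear_compose[OF bounded_linear_minus[OF bounded_linear_ident]])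

lemma C1_on_diff: "C1_on U f \<Longrightarrow> C1_on U g \<Longrightarrow> C1_on U (\<lambda>x. f x - g x)"
  using C1_on_add[OF _ C1_on_minus] by fastforce

lemma C1_on_divide:
  fixes f g :: "'a::real_normed_vector \<Rightarrow> real"
  shows "C1_on U f \<Longrightarrow> C1_on U g \<Longrightarrow> (\<And>x. x \<in> U \<Longrightarrow> g x \<noteq> 0) \<Longrightarrow> C1_on U (\<lambda>x. f x / g x)"
  unfolding divide_inverse by (intro C1_on_mult C1_on_inverse)

lemma C1_on_cong_open:
  assumes "C1_on U f" "open U" "\<And>x. x \<in> U \<Longrightarrow> g x = f x"
  shows "C1_on U g"
proof -
  obtain f' where f': "\<And>x. x \<in> U \<Longrightarrow> (f has_derivative blinfun_apply (f' x)) (at x)" "continuous_on U f'"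
    using assms(1) by (rule C1_onE) blast
  have "(g has_derivative blinfun_apply (f' x)) (at x)" if "x \<in> U" for x
    by (rule has_derivative_transform_within_open[OF f'(1)[OF that] assms(2) that]) (simp add: assms(3))
  with f'(2) show ?thesis unfolding C1_on_def by blast
qed

text \<open>Both smoothness classes are local because the derivative is unique.\<close>

lemma derivative_of_local_derivatives:
  assumes "\<And>x. x \<in> U \<Longrightarrow> \<exists>V f'. open V \<and> x \<in> V \<and>
      (\<forall>y\<in>V. (f has_derivative blinfun_apply (f' y)) (at y)) \<and> P V f'"
    and cong: "\<And>V f' g'. open V \<Longrightarrow> P V f' \<Longrightarrow> (\<And>x. x \<in> V \<Longrightarrow> g' x = f' x) \<Longrightarrow> P V g'"
  shows "\<exists>g'. \<forall>x\<in>U. (f has_derivative blinfun_apply (g' x)) (at x) \<and>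
    (\<exists>V. open V \<and> x \<in> V \<and> P V g')"
proof -
  \<comment> \<open>Local derivatives have to be glued. The description selects the only derivative
    at each point, so \<open>g'\<close> agrees on \<open>V\<close> with any local choice
    \<open>f'\<close>, and \<open>cong\<close> transfers the regularity \<open>P\<close> to
    it.\<close>
  define g' where "g' x = (THE D. (f has_derivative blinfun_apply D) (at x))" for x
  have g'_eq: "g' x = D" if "(f has_derivative blinfun_apply D) (at x)" for x D
    unfolding g'_def using that
    by (intro the_equality) (auto simp: blinfun_apply_inject[symmetric] intro: has_derivative_unique)
  have "(f has_derivative blinfun_apply (g' x)) (at x) \<and> (\<exists>V. open V \<and> x \<in> V \<and> P V g')"
    if x: "x \<in> U" for x
  proof -
    from assms(1)[OF x] obtain V f' where V: "open V" "x \<in> V" "P V f'"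
      and f': "\<forall>y\<in>V. (f has_derivative blinfun_apply (f' y)) (at y)"
      by (elim exE conjE)
    have eq: "g' y = f' y" if "y \<in> V" for y
      using f' that by (intro g'_eq) simp
    show ?thesis
      using f' V(2) eq[OF V(2)] V(1) cong[OF V(1,3) eq] by auto
  qed
  then show ?thesis by blast
qed

lemma C1_on_local:
  assumes "\<And>x. x \<in> U \<Longrightarrow> \<exists>V. open V \<and> x \<in> V \<and> C1_on V f"
  shows "C1_on U f"
proof -
  have "\<exists>g'. \<forall>x\<in>U. (f has_derivative blinfun_apply (g' x)) (at x) \<and>
    (\<exists>V. open V \<and> x \<in> V \<and> continuous_on V g')"
  proof (rule derivative_of_local_derivatives[of U f continuous_on])
    show "\<exists>V f'. open V \<and> x \<in> V \<and> (\<forall>y\<in>V. (f has_derivative blinfun_apply (f' y)) (at y)) \<and> continuous_on V f'"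
      if "x \<in> U" for x
      using assms[OF that] unfolding C1_on_def by blast
    show "continuous_on V g'" if "continuous_on V f'" "\<And>x. x \<in> V \<Longrightarrow> g' x = f' x"
      for V and f' g' :: "'a \<Rightarrow> 'a \<Rightarrow>\<^sub>L 'b"
      using that by (simp cong: continuous_on_cong)
  qed
  then obtain g' where g': "\<And>x. x \<in> U \<Longrightarrow> (f has_derivative blinfun_apply (g' x)) (at x)"
    "\<And>x. x \<in> U \<Longrightarrow> \<exists>V. open V \<and> x \<in> V \<and> continuous_on V g'"
    by blast
  have "continuous_on U g'"
    using g'(2) by (meson continuous_at_imp_continuous_on continuous_on_eq_continuous_at)
  then show ?thesis unfolding C1_on_def using g'(1) by blast
qed

text \<open>The derivative as an operator is the finite sum of the rank-one operators
  \<open>v \<mapsto> (v \<bullet> i) c\<close> with \<open>c\<close> its value on the basis vector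
  \<open>i\<close>. Such an operator depends linearly on \<open>c\<close>, so regularity of the
  columns passes to the operator-valued map.\<close>

lemma C2_onI:
  fixes f :: "'a::euclidean_space \<Rightarrow> 'b::real_normed_vector"
  assumes f': "\<And>x. x \<in> U \<Longrightarrow> (f has_derivative f' x) (at x)"
    and C1: "\<And>i. i \<in> Basis \<Longrightarrow> C1_on U (\<lambda>x. f' x i)"
  shows "C2_on U f"
proof -
  define L :: "'a \<Rightarrow> 'b \<Rightarrow> 'a \<Rightarrow>\<^sub>L 'b" where
    "L i c = blinfun_scaleR_left c o\<^sub>L blinfun_inner_left i" for i c
  have L: "L i c v = (v \<bullet> i) *\<^sub>R c" for i c v
    by (simp add: L_def inner_commute)
  have bl: "bounded_linear (L i)" for i
    unfolding L_def
    by (intro bounded_linear_compose[OF bounded_bilinear.bounded_linear_left[OF bounded_bilinear_blinfun_compose]]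
          bounded_linear_blinfun_scaleR_left)
  define F where "F x = (\<Sum>i\<in>Basis. L i (f' x i))" for x
  have F: "blinfun_apply (F x) = f' x" if "x \<in> U" for x
  proof
    fix v
    interpret linear "f' x" using f'[OF that] by (rule has_derivative_linear)
    have "f' x v = f' x (\<Sum>i\<in>Basis. (v \<bullet> i) *\<^sub>R i)" by (simp add: euclidean_representation)
    also have "\<dots> = F x v"
      by (simp add: F_def sum scaleR blinfun.sum_left L)
    finally show "F x v = f' x v" by simp
  qed
  have "C1_on U F"
    unfolding F_def by (intro C1_on_sum C1_on_linear_compose[OF bl] C1)
  moreover have "(f has_derivative blinfun_apply (F x)) (at x)" if "x \<in> U" for x
    using f'[OF that] F[OF that] by simp
  ultimately show ?thesis unfolding C2_on_def by blast
qed

lemma C2_onE: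
  assumes "C2_on U f"
  obtains f' where "\<And>x. x \<in> U \<Longrightarrow> (f has_derivative f' x) (at x)"
    and "\<And>v. C1_on U (\<lambda>x. f' x v)"
proof -
  obtain f' where f': "\<And>x. x \<in> U \<Longrightarrow> (f has_derivative blinfun_apply (f' x)) (at x)" "C1_on U f'"
    using assms unfolding C2_on_def by blast
  have "C1_on U (\<lambda>x. f' x v)" for v
    by (rule C1_on_linear_compose[OF blinfun.bounded_linear_left f'(2)])
  with f'(1) show thesis by (rule that)
qed

lemma C2_on_imp_C1_on: "C2_on U f \<Longrightarrow> C1_on U f"
  unfolding C2_on_def C1_on_def[of U f] using C1_on_imp_continuous_on by blast

lemma C2_on_cong_open:
  assumes "C2_on U f" "open U" "\<And>x. x \<in> U \<Longrightarrow> g x = f x"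
  shows "C2_on U g"
proof -
  obtain f' where f': "\<And>x. x \<in> U \<Longrightarrow> (f has_derivative blinfun_apply (f' x)) (at x)" "C1_on U f'"
    using assms(1) unfolding C2_on_def by blast
  have "(g has_derivative blinfun_apply (f' x)) (at x)" if "x \<in> U" for x
    by (rule has_derivative_transform_within_open[OF f'(1)[OF that] assms(2) that]) (simp add: assms(3))
  with f'(2) show ?thesis unfolding C2_on_def by blast
qed

lemma C2_on_local:
  assumes "\<And>x. x \<in> U \<Longrightarrow> \<exists>V. open V \<and> x \<in> V \<and> C2_on V f"
  shows "C2_on U f"
proof -
  have "\<exists>g'. \<forall>x\<in>U. (f has_derivative blinfun_apply (g' x)) (at x) \<and>
    (\<exists>V. open V \<and> x \<in> V \<and> C1_on V g')"
  proof (rule derivative_of_local_derivatives[of U f C1_on])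
    show "\<exists>V f'. open V \<and> x \<in> V \<and> (\<forall>y\<in>V. (f has_derivative blinfun_apply (f' y)) (at y)) \<and> C1_on V f'"
      if "x \<in> U" for x
      using assms[OF that] unfolding C2_on_def by blast
    show "C1_on V g'" if "open V" "C1_on V f'" "\<And>x. x \<in> V \<Longrightarrow> g' x = f' x"
      for V and f' g' :: "'a \<Rightarrow> 'a \<Rightarrow>\<^sub>L 'b"
      using that C1_on_cong_open by blast
  qed
  then obtain g' where g': "\<And>x. x \<in> U \<Longrightarrow> (f has_derivative blinfun_apply (g' x)) (at x)"
    "\<And>x. x \<in> U \<Longrightarrow> \<exists>V. open V \<and> x \<in> V \<and> C1_on V g'"
    by blast
  then show ?thesis unfolding C2_on_def using C1_on_local by blast
qed

lemma C2_on_bounded_linear: "bounded_linear L \<Longrightarrow> C2_on U L"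
  unfolding C2_on_def
  by (intro exI[of _ "\<lambda>x. Blinfun L"])
     (simp_all add: bounded_linear_Blinfun_apply bounded_linear_imp_has_derivative)

lemma C2_on_const: "C2_on U (\<lambda>x. c)"
  unfolding C2_on_def by (intro exI[of _ "\<lambda>x. 0"]) (auto simp: zero_blinfun.rep_eq)

lemma C2_on_add:
  assumes "C2_on U f" "C2_on U g"
  shows "C2_on U (\<lambda>x. f x + g x)"
proof -
  obtain f' where f': "\<And>x. x \<in> U \<Longrightarrow> (f has_derivative blinfun_apply (f' x)) (at x)" "C1_on U f'"
    using assms(1) unfolding C2_on_def by blast
  obtain g' where g': "\<And>x. x \<in> U \<Longrightarrow> (g has_derivative blinfun_apply (g' x)) (at x)" "C1_on U g'"
    using assms(2) unfolding C2_on_def by blast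
  show ?thesis unfolding C2_on_def
    by (intro exI[of _ "\<lambda>x. f' x + g' x"])
      (auto intro!: C1_on_add f' g' simp: plus_blinfun.rep_eq has_derivative_add f'(1) g'(1))
qed

text \<open>In the chain rule \<open>g' (f x) (f' x v)\<close> both the operator and its argument
  vary with \<open>x\<close>. Expanding the argument in the basis turns the expression into a sum of
  products of C1 functions.\<close>

lemma C2_on_compose:
  fixes f :: "'a::euclidean_space \<Rightarrow> 'b::euclidean_space" and g :: "'b \<Rightarrow> real"
  assumes f: "C2_on U f" and g: "C2_on V g" and "f ` U \<subseteq> V"
  shows "C2_on U (\<lambda>x. g (f x))"
proof -
  obtain f' where f': "\<And>x. x \<in> U \<Longrightarrow> (f has_derivative f' x) (at x)" "\<And>v. C1_on U (\<lambda>x. f' x v)"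
    using f by (rule C2_onE) blast
  obtain g' where g': "\<And>x. x \<in> V \<Longrightarrow> (g has_derivative g' x) (at x)" "\<And>v. C1_on V (\<lambda>x. g' x v)"
    using g by (rule C2_onE) blast
  have fV: "f x \<in> V" if "x \<in> U" for x using that assms by auto
  have eq: "g' y v = (\<Sum>i\<in>Basis. (v \<bullet> i) * g' y i)" if "y \<in> V" for y v
  proof -
    interpret linear "g' y" using g'(1)[OF that] by (rule has_derivative_linear)
    have "g' y v = g' y (\<Sum>i\<in>Basis. (v \<bullet> i) *\<^sub>R i)" by (simp add: euclidean_representation)
    then show ?thesis by (simp add: sum scaleR)
  qed
  show ?thesis
  proof (rule C2_onI)
    show "((\<lambda>x. g (f x)) has_derivative (\<lambda>v. \<Sum>i\<in>Basis. (f' x v \<bullet> i) * g' (f x) i)) (at x)"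
      if "x \<in> U" for x
      by (rule has_derivative_eq_rhs[OF has_derivative_compose[OF f'(1)[OF that] g'(1)[OF fV[OF that]]]])
         (rule ext, rule eq[OF fV[OF that]])
    show "C1_on U (\<lambda>x. \<Sum>i\<in>Basis. (f' x v \<bullet> i) * g' (f x) i)" for v
      by (intro C1_on_sum C1_on_mult C1_on_linear_compose[OF bounded_linear_inner_left] f'(2)
          C1_on_compose[OF C2_on_imp_C1_on[OF f] g'(2)] assms)
  qed
qed

lemma C2_on_mult:
  fixes f g :: "'a::euclidean_space \<Rightarrow> real"
  assumes f: "C2_on U f" and g: "C2_on U g"
  shows "C2_on U (\<lambda>x. f x * g x)"
proof -
  obtain f' where f': "\<And>x. x \<in> U \<Longrightarrow> (f has_derivative f' x) (at x)" "\<And>v. C1_on U (\<lambda>x. f' x v)"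
    using f by (rule C2_onE) blast
  obtain g' where g': "\<And>x. x \<in> U \<Longrightarrow> (g has_derivative g' x) (at x)" "\<And>v. C1_on U (\<lambda>x. g' x v)"
    using g by (rule C2_onE) blast
  show ?thesis
  proof (rule C2_onI)
    show "((\<lambda>x. f x * g x) has_derivative (\<lambda>v. f x * g' x v + f' x v * g x)) (at x)" if "x \<in> U" for x
      using that by (intro has_derivative_mult f' g')
    show "C1_on U (\<lambda>x. f x * g' x v + f' x v * g x)" for v
      by (intro C1_on_add C1_on_mult f' g' C2_on_imp_C1_on f g)
  qed
qed

section \<open>Change of variables\<close>

text \<open>The change of variables theorem compares finite integrals, while here both sides may be
  infinite. It is applied on an exhausting sequence of subsets of \<open>B\<close>, and the general
  case follows by continuity from below.\<close>

lemma nn_integral_change_of_variables_image: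
  fixes \<theta> :: "real^'n::{finite,wellorder} \<Rightarrow> real^'n::_" and f g :: "real^'n::_ \<Rightarrow> real"
  assumes B: "B \<in> sets borel"
    and der: "\<And>x. x \<in> B \<Longrightarrow> (\<theta> has_derivative \<theta>' x) (at x)"
    and inj: "inj_on \<theta> B"
    and img: "\<And>A. A \<in> sets borel \<Longrightarrow> A \<subseteq> B \<Longrightarrow> \<theta> ` A \<in> sets borel"
    and f: "f \<in> borel_measurable borel" "\<And>x. 0 \<le> f x"
    and g: "g \<in> borel_measurable borel"
    and gf: "\<And>x. x \<in> B \<Longrightarrow> g x = \<bar>det (matrix (\<theta>' x))\<bar> * f (\<theta> x)"
  shows "(\<integral>\<^sup>+x\<in>B. ennreal (g x) \<partial>lborel) = (\<integral>\<^sup>+y\<in>\<theta> ` B. ennreal (f y) \<partial>lborel)"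
proof -
  \<comment> \<open>Bounding both the point and the integrand makes \<open>g\<close> integrable on
    each \<open>C n\<close>.\<close>
  define C where "C n = {x \<in> B. norm x \<le> real n \<and> g x \<le> real n}" for n
  have C_borel: "C n \<in> sets borel" for n
  proof -
    have "C n = B \<inter> {x \<in> space borel. norm x \<le> real n} \<inter> {x \<in> space borel. g x \<le> real n}"
      by (auto simp: C_def)
    also have "\<dots> \<in> sets borel" using B g by measurable
    finally show ?thesis .
  qed
  have CB: "C n \<subseteq> B" for n by (auto simp: C_def)
  have g0: "0 \<le> g x" if "x \<in> B" for x using gf[OF that] f(2) by simp
  have fin: "(\<integral>\<^sup>+x\<in>C n. ennreal (g x) \<partial>lborel) = (\<integral>\<^sup>+y\<in>\<theta> ` C n. ennreal (f y) \<partial>lborel)" for n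
  proof -
    have "C n \<subseteq> cball 0 (real n)" by (auto simp: C_def)
    then have em: "emeasure lborel (C n) < \<infinity>"
      by (meson bounded_cball bounded_subset emeasure_bounded_finite)
    have "set_integrable lborel (C n) g"
      unfolding set_integrable_def
    proof (rule integrableI_bounded_set_indicator[where B="real n"])
      show "AE x\<in>C n in lborel. norm (g x) \<le> real n"
        using g0 by (auto simp: C_def)
    qed (use g em C_borel in auto)
    then have gi: "g absolutely_integrable_on C n"
      using C_borel g by (auto simp: set_integrable_def intro!: integrable_completion[THEN iffD2])
    let ?b = "integral (C n) g"
    \<comment> \<open>The theorem is stated for vector-valued integrands; scalars are passed through
      \<open>real^1\<close> by \<open>vec\<close>.\<close>
    have cov: "(\<lambda>x. \<bar>det (matrix (\<theta>' x))\<bar> *\<^sub>R (vec (f (\<theta> x)) :: real^1)) absolutely_integrable_on C n \<and>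
        integral (C n) (\<lambda>x. \<bar>det (matrix (\<theta>' x))\<bar> *\<^sub>R (vec (f (\<theta> x)) :: real^1)) = vec ?b \<longleftrightarrow>
        (\<lambda>y. vec (f y) :: real^1) absolutely_integrable_on \<theta> ` C n \<and> integral (\<theta> ` C n) (\<lambda>y. vec (f y) :: real^1) = vec ?b"
    proof (rule has_absolute_integral_change_of_variables)
      show "C n \<in> sets lebesgue" using C_borel[of n] by auto
      show "(\<theta> has_derivative \<theta>' x) (at x within C n)" if "x \<in> C n" for x
        using der CB that by (blast intro: has_derivative_at_withinI)
      show "inj_on \<theta> (C n)" using inj CB inj_on_subset by blast
    qed
    have eq: "\<bar>det (matrix (\<theta>' x))\<bar> *\<^sub>R (vec (f (\<theta> x)) :: real^1) = vec (g x)" if "x \<in> C n" for x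
      using gf[of x] subsetD[OF CB that] by (simp add: vec_eq_iff)
    have "(\<lambda>x. vec (g x) :: real^1) absolutely_integrable_on C n"
      using gi by (simp add: absolutely_integrable_on_1_iff)
    then have "(\<lambda>x. \<bar>det (matrix (\<theta>' x))\<bar> *\<^sub>R (vec (f (\<theta> x)) :: real^1)) absolutely_integrable_on C n"
      using eq by (subst set_integrable_cong[OF refl refl]) auto
    moreover have "integral (C n) (\<lambda>x. \<bar>det (matrix (\<theta>' x))\<bar> *\<^sub>R (vec (f (\<theta> x)) :: real^1)) = vec ?b"
      using eq by (subst integral_cong[where g="\<lambda>x. vec (g x)"]) (auto simp: integral_on_1_eq)
    ultimately have "(\<lambda>y. vec (f y) :: real^1) absolutely_integrable_on \<theta> ` C n \<and>
        integral (\<theta> ` C n) (\<lambda>y. vec (f y) :: real^1) = vec ?b"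
      using cov by blast
    then have fi: "(f has_integral ?b) (\<theta> ` C n)"
      unfolding absolutely_integrable_on_1_iff integral_on_1_eq
      by (auto simp: has_integral_iff absolutely_integrable_on_def vec_eq_iff)
    have "(g has_integral ?b) (C n)"
      using gi by (simp add: absolutely_integrable_on_def has_integral_integral)
    then have "(\<integral>\<^sup>+x\<in>C n. ennreal (g x) \<partial>lborel) = ennreal ?b"
      using g0 CB[of n] by (intro nn_integral_has_integral_lebesgue') auto
    also have "\<dots> = (\<integral>\<^sup>+y\<in>\<theta> ` C n. ennreal (f y) \<partial>lborel)"
      using nn_integral_has_integral_lebesgue'[OF f(2) fi] by simp
    finally show ?thesis .
  qed
  \<comment> \<open>Reading both integrals as measures of sets makes continuity along the increasing
    sets \<open>C n\<close> and their images available.\<close>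
  let ?M = "density lborel (\<lambda>x. ennreal (g x))" and ?N = "density lborel (\<lambda>x. ennreal (f x))"
  have eqn: "emeasure ?M (C n) = emeasure ?N (\<theta> ` C n)" for n
    using fin[of n] C_borel[of n] img[OF C_borel CB, of n] f g by (simp add: emeasure_density)
  have inc: "incseq C"
    by (auto simp: incseq_def C_def intro: order_trans)
  have UC: "(\<Union>n. C n) = B"
  proof
    show "B \<subseteq> (\<Union>n. C n)"
    proof
      fix x assume "x \<in> B"
      moreover obtain n where "max (norm x) (g x) \<le> real n" using real_arch_simple by blast
      ultimately show "x \<in> (\<Union>n. C n)" by (auto simp: C_def)
    qed
  qed (auto simp: C_def)
  have "(\<lambda>n. emeasure ?M (C n)) \<longlonglongrightarrow> emeasure ?M (\<Union>n. C n)"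
    by (rule Lim_emeasure_incseq) (use C_borel inc in auto)
  moreover have "(\<lambda>n. emeasure ?N (\<theta> ` C n)) \<longlonglongrightarrow> emeasure ?N (\<Union>n. \<theta> ` C n)"
    by (rule Lim_emeasure_incseq)
       (use img[OF C_borel CB] inc in \<open>auto simp: incseq_def image_mono\<close>)
  moreover have "(\<Union>n. \<theta> ` C n) = \<theta> ` B" using UC by blast
  ultimately have "emeasure ?M B = emeasure ?N (\<theta> ` B)"
    unfolding eqn UC by (auto intro: LIMSEQ_unique)
  then show ?thesis
    using B img[OF B] f g by (simp add: emeasure_density)
qed

section \<open>Surfaces with a global chart\<close>

definition param_normal :: "(real^2 \<Rightarrow> real^3) \<Rightarrow> real^2 \<Rightarrow> real^3" where
  "param_normal \<psi> u =
     cross3 (frechet_derivative \<psi> (at u) (axis 1 1)) (frechet_derivative \<psi> (at u) (axis 2 1))"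

text \<open>Length of the horizontal part of a covector. For the Euclidean gradient of a
  differentiable function it is \<open>W\<close>; for the normal of a chart it turns out to be the
  perimeter integrand.\<close>

definition hnorm :: "real^3 \<Rightarrow> real^3 \<Rightarrow> real" where
  "hnorm v g = sqrt ((v \<bullet> X1 g)\<^sup>2 + (v \<bullet> X2 g)\<^sup>2)"

lemma area_element_eq: "area_element \<psi> u = norm (param_normal \<psi> u)"
  by (simp add: area_element_def param_normal_def)

lemma param_normal_eq:
  assumes "(\<psi> has_derivative \<psi>') (at u)"
  shows "param_normal \<psi> u = cross3 (\<psi>' (axis 1 1)) (\<psi>' (axis 2 1))"
  using frechet_derivative_at[OF assms] by (simp add: param_normal_def)

lemma vec2_expand: "(v :: real^2) = v$1 *\<^sub>R axis 1 1 + v$2 *\<^sub>R axis 2 1"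
  by (simp add: vec_eq_iff forall_2 axis_def)

text \<open>Both columns of the composed derivative are combinations of the two columns of
  \<open>\<psi>'\<close>, so bilinearity and antisymmetry of the cross product leave exactly the
  determinant. This is the Jacobian factor by which area elements of two parametrizations
  differ.\<close>

lemma param_normal_compose:
  assumes \<theta>: "(\<theta> has_derivative \<theta>') (at u)" and \<psi>: "(\<psi> has_derivative \<psi>') (at (\<theta> u))"
    and \<sigma>: "open U" "u \<in> U" "\<And>x. x \<in> U \<Longrightarrow> \<sigma> x = \<psi> (\<theta> x)"
  shows "param_normal \<sigma> u = det (matrix \<theta>') *\<^sub>R param_normal \<psi> (\<theta> u)"
proof -
  have "((\<lambda>x. \<psi> (\<theta> x)) has_derivative (\<lambda>v. \<psi>' (\<theta>' v))) (at u)"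
    by (rule has_derivative_compose[OF \<theta> \<psi>])
  then have "(\<sigma> has_derivative (\<lambda>v. \<psi>' (\<theta>' v))) (at u)"
    by (rule has_derivative_transform_within_open[OF _ \<sigma>(1,2)]) (simp add: \<sigma>(3))
  then have *: "param_normal \<sigma> u = cross3 (\<psi>' (\<theta>' (axis 1 1))) (\<psi>' (\<theta>' (axis 2 1)))"
    by (rule param_normal_eq)
  have lin: "\<psi>' v = v$1 *\<^sub>R \<psi>' (axis 1 1) + v$2 *\<^sub>R \<psi>' (axis 2 1)" for v
  proof -
    interpret linear \<psi>' using \<psi> by (rule has_derivative_linear)
    show ?thesis by (subst vec2_expand[of v]) (simp only: add scaleR)
  qed
  have cross: "cross3 (a *\<^sub>R p + b *\<^sub>R q) (c *\<^sub>R p + d *\<^sub>R q) = (a * d - c * b) *\<^sub>R cross3 p q"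
    for a b c d :: real and p q
    by (simp add: cross3_simps forall_3)
  show ?thesis
    unfolding * lin[of "\<theta>' (axis 1 1)"] lin[of "\<theta>' (axis 2 1)"] cross param_normal_eq[OF \<psi>]
    by (simp add: det_2 matrix_def)
qed

lemma hnorm_components:
  "hnorm v g = sqrt ((v$1 - v$3 * g$2 / 2)\<^sup>2 + (v$2 + v$3 * g$1 / 2)\<^sup>2)"
proof -
  have "v \<bullet> X1 g = v$1 - v$3 * g$2 / 2" "v \<bullet> X2 g = v$2 + v$3 * g$1 / 2"
    by (simp_all add: X1_def X2_def inner_vec_def sum_3)
  then show ?thesis by (simp add: hnorm_def)
qed

lemma continuous_hnorm:
  "continuous_on A f \<Longrightarrow> continuous_on A g \<Longrightarrow> continuous_on A (\<lambda>x. hnorm (f x) (g x))"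
  unfolding hnorm_components by (intro continuous_intros) auto

lemma euclid_grad_inner:
  assumes "\<phi> differentiable at g"
  shows "frechet_derivative \<phi> (at g) v = euclid_grad \<phi> g \<bullet> v"
proof -
  interpret linear "frechet_derivative \<phi> (at g)"
    using assms frechet_derivative_works has_derivative_linear by blast
  have "v = (\<Sum>i\<in>UNIV. v$i *\<^sub>R axis i 1)"
    by (simp add: basis_expansion[symmetric] scalar_mult_eq_scaleR[symmetric])
  then have "frechet_derivative \<phi> (at g) v = frechet_derivative \<phi> (at g) (\<Sum>i\<in>UNIV. v$i *\<^sub>R axis i 1)"
    by simp
  also have "\<dots> = euclid_grad \<phi> g \<bullet> v"
    by (simp add: sum scaleR euclid_grad_def inner_vec_def mult.commute)
  finally show ?thesis .
qed

text \<open>The left inverse is C1 on the whole space and not merely on the surface. The range is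
  then closed as the fixed point set of \<open>\<psi> \<circ> \<rho>\<close>, and
  \<open>\<rho>\<close> composed with any other C1 parametrization is C1 by the ordinary chain
  rule.\<close>

locale C1_chart =
  fixes \<psi> :: "real^2 \<Rightarrow> real^3" and \<rho> :: "real^3 \<Rightarrow> real^2"
  assumes C1_\<psi>: "C1_on UNIV \<psi>" and C1_\<rho>: "C1_on UNIV \<rho>" and \<rho>_\<psi> [simp]: "\<rho> (\<psi> w) = w"
begin

lemma continuous_\<psi>: "continuous_on A \<psi>" and continuous_\<rho>: "continuous_on B \<rho>"
  using C1_on_imp_continuous_on[OF C1_\<psi>] C1_on_imp_continuous_on[OF C1_\<rho>]
  by (auto intro: continuous_on_subset)

lemma borel_measurable_\<psi> [measurable]: "\<psi> \<in> borel_measurable borel"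
  and borel_measurable_\<rho> [measurable]: "\<rho> \<in> borel_measurable borel"
  by (intro borel_measurable_continuous_onI continuous_\<psi> continuous_\<rho>)+

lemma \<psi>_\<rho>: "g \<in> range \<psi> \<Longrightarrow> \<psi> (\<rho> g) = g"
  by auto

lemma closed_range: "closed (range \<psi>)"
proof -
  have "range \<psi> = {g. \<psi> (\<rho> g) = g}" using \<psi>_\<rho> by (auto intro: rangeI[of \<psi>] dest: sym)
  then show ?thesis
    by (auto intro!: closed_Collect_eq continuous_on_compose2[OF continuous_\<psi>[of UNIV]] continuous_\<rho>)
qed

lemma homeomorphism: "homeomorphism UNIV (range \<psi>) \<psi> \<rho>"
  by (auto simp: homeomorphism_def continuous_\<psi> continuous_\<rho> image_image)

lemma \<psi>_derivative: "(\<psi> has_derivative frechet_derivative \<psi> (at w)) (at w)"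
  by (metis C1_onE C1_\<psi> UNIV_I differentiableI frechet_derivative_works)

lemma \<rho>_derivative: "(\<rho> has_derivative frechet_derivative \<rho> (at g)) (at g)"
  by (metis C1_onE C1_\<rho> UNIV_I differentiableI frechet_derivative_works)

text \<open>Differentiating \<open>\<rho> (\<psi> w) = w\<close> gives the derivative of
  \<open>\<psi>\<close> a linear left inverse, so its two columns are independent.\<close>

lemma param_normal_nonzero: "param_normal \<psi> w \<noteq> 0"
proof
  let ?D = "frechet_derivative \<psi> (at w)" and ?R = "frechet_derivative \<rho> (at (\<psi> w))"
  have "((\<lambda>w. \<rho> (\<psi> w)) has_derivative (\<lambda>v. ?R (?D v))) (at w)"
    by (rule has_derivative_compose[OF \<psi>_derivative \<rho>_derivative])
  moreover have "((\<lambda>w. \<rho> (\<psi> w)) has_derivative (\<lambda>v. v)) (at w)"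
    by simp
  ultimately have RD: "?R (?D v) = v" for v
    using has_derivative_unique by metis
  interpret linear ?R using \<rho>_derivative by (rule has_derivative_linear)
  assume "param_normal \<psi> w = 0"
  then have "collinear {0, ?D (axis 1 1), ?D (axis 2 1)}"
    by (simp add: param_normal_def cross_eq_0)
  then consider "?D (axis 1 1) = 0" | "?D (axis 2 1) = 0" | c where "?D (axis 2 1) = c *\<^sub>R ?D (axis 1 1)"
    unfolding collinear_lemma by blast
  then show False
  proof cases
    case 1 then show False using RD[of "axis 1 1"] zero by (simp add: axis_eq_0_iff)
  next
    case 2 then show False using RD[of "axis 2 1"] zero by (simp add: axis_eq_0_iff)
  next
    case 3
    then have "(axis 2 1 :: real^2) = c *\<^sub>R axis 1 1" using RD scaleR by metis
    then show False by (simp add: vec_eq_iff forall_2 axis_def)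
  qed
qed

lemma continuous_param_normal: "continuous_on A (param_normal \<psi>)"
proof -
  obtain \<psi>' where \<psi>': "\<And>x. (\<psi> has_derivative blinfun_apply (\<psi>' x)) (at x)" "continuous_on UNIV \<psi>'"
    using C1_\<psi> unfolding C1_on_def by auto
  have "param_normal \<psi> = (\<lambda>w. cross3 (\<psi>' w (axis 1 1)) (\<psi>' w (axis 2 1)))"
    using param_normal_eq[OF \<psi>'(1)] by auto
  moreover have "continuous_on A \<psi>'" using \<psi>'(2) continuous_on_subset by blast
  ultimately show ?thesis
    by (simp add: continuous_on_cross blinfun.continuous_on continuous_on_const)
qed

lemma borel_measurable_param_normal [measurable]: "param_normal \<psi> \<in> borel_measurable borel"
  by (intro borel_measurable_continuous_onI continuous_param_normal)

lemma local_parametrization_self: "local_parametrization (range \<psi>) UNIV \<psi>"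
  unfolding local_parametrization_def
  using C1_\<psi> homeomorphism param_normal_nonzero by (auto simp: area_element_eq)

text \<open>Explicit candidate for the measure that \<open>surface_measure\<close> only
  describes.\<close>

definition pushforward :: "(real^3) measure" where
  "pushforward = distr (density lborel (\<lambda>w. ennreal (area_element \<psi> w))) (restrict_space borel (range \<psi>)) \<psi>"

lemma sets_pushforward [simp]: "sets pushforward = sets (restrict_space borel (range \<psi>))"
  by (simp add: pushforward_def)

lemma \<psi>_measurable_range [measurable]: "\<psi> \<in> measurable borel (restrict_space borel (range \<psi>))"
  by (rule measurable_restrict_space2) auto

lemma emeasure_pushforward:
  assumes "E \<in> sets borel" "E \<subseteq> range \<psi>"
  shows "emeasure pushforward E = (\<integral>\<^sup>+w\<in>\<psi> -` E. ennreal (area_element \<psi> w) \<partial>lborel)"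
proof -
  have E: "E \<in> sets (restrict_space borel (range \<psi>))"
    using assms closed_range by (simp add: sets_restrict_space_iff)
  have "\<psi> -` E \<in> sets borel"
    using measurable_sets[OF borel_measurable_\<psi> assms(1)] by simp
  then show ?thesis
    unfolding pushforward_def using E
    by (simp add: emeasure_distr emeasure_density area_element_eq)
qed

text \<open>The transition map \<open>\<theta> = \<rho> \<circ> \<sigma>\<close> is differentiable
  and injective on \<open>U\<close>, and \<open>\<sigma> = \<psi> \<circ> \<theta>\<close> there.
  The two area elements differ by the Jacobian of \<open>\<theta>\<close>, so the area formula for
  \<open>\<sigma>\<close> is a change of variables in the one for \<open>\<psi>\<close>.\<close>

lemma local_parametrization_area:
  assumes \<sigma>: "local_parametrization (range \<psi>) U \<sigma>" and B: "B \<in> sets borel" "B \<subseteq> U"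
  shows "emeasure pushforward (\<sigma> ` B) = (\<integral>\<^sup>+u\<in>B. ennreal (area_element \<sigma> u) \<partial>lborel)"
proof -
  obtain \<sigma>' where \<sigma>': "open U" "C1_on U \<sigma>" "openin (top_of_set (range \<psi>)) (\<sigma> ` U)" "homeomorphism U (\<sigma> ` U) \<sigma> \<sigma>'"
    using \<sigma> unfolding local_parametrization_def by auto
  define \<theta> where "\<theta> u = \<rho> (\<sigma> u)" for u
  have sub: "\<sigma> ` U \<subseteq> range \<psi>" using \<sigma>'(3) openin_imp_subset by blast
  then have \<psi>\<theta>: "\<sigma> u = \<psi> (\<theta> u)" if "u \<in> U" for u
    unfolding \<theta>_def using that \<psi>_\<rho> by auto
  obtain D where D: "\<And>x. x \<in> U \<Longrightarrow> (\<sigma> has_derivative blinfun_apply (D x)) (at x)" "continuous_on U D"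
    using \<sigma>'(2) by (rule C1_onE) blast
  define \<theta>' where "\<theta>' u v = frechet_derivative \<rho> (at (\<sigma> u)) (D u v)" for u v
  have \<theta>': "(\<theta> has_derivative \<theta>' u) (at u)" if "u \<in> U" for u
    unfolding \<theta>_def \<theta>'_def by (rule has_derivative_compose[OF D(1)[OF that] \<rho>_derivative])
  have inv: "\<sigma>' (\<sigma> u) = u" if "u \<in> U" for u
    using \<sigma>'(4) that by (simp add: homeomorphism_def)
  have borelU: "\<sigma> ` U \<in> sets borel"
    using \<sigma>'(3) closed_range by (auto simp: openin_open)
  \<comment> \<open>Direct images of Borel sets are Borel here because they are preimages under the
    continuous inverse \<open>\<sigma>'\<close>.\<close>
  have img: "\<sigma> ` A \<in> sets borel" if A: "A \<in> sets borel" "A \<subseteq> U" for A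
  proof -
    have "\<sigma>' \<in> borel_measurable (restrict_space borel (\<sigma> ` U))"
      using \<sigma>'(4) by (intro borel_measurable_continuous_on_restrict) (simp add: homeomorphism_def)
    from measurable_sets[OF this A(1)] have "\<sigma>' -` A \<inter> \<sigma> ` U \<in> sets borel"
      using borelU by (simp add: sets_restrict_space_iff space_restrict_space)
    moreover have "\<sigma>' -` A \<inter> \<sigma> ` U = \<sigma> ` A" using inv A(2) by auto
    ultimately show ?thesis by simp
  qed
  \<comment> \<open>Written as a preimage under \<open>\<psi>\<close>, the image under the
    transition map inherits measurability from the image under \<open>\<sigma>\<close>.\<close>
  have \<theta>_img: "\<theta> ` A = \<psi> -` (\<sigma> ` A)" if "A \<subseteq> U" for A
  proof
    show "\<theta> ` A \<subseteq> \<psi> -` \<sigma> ` A" using \<psi>\<theta> that by force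
    show "\<psi> -` \<sigma> ` A \<subseteq> \<theta> ` A"
    proof
      fix w assume "w \<in> \<psi> -` \<sigma> ` A"
      then obtain u where "u \<in> A" "\<psi> w = \<sigma> u" by auto
      then show "w \<in> \<theta> ` A" unfolding \<theta>_def by (metis \<rho>_\<psi> imageI)
    qed
  qed
  have "inj_on \<theta> U"
    by (metis \<psi>\<theta> inv inj_onI)
  have area: "area_element \<sigma> u = \<bar>det (matrix (\<theta>' u))\<bar> * area_element \<psi> (\<theta> u)" if "u \<in> U" for u
  proof -
    have "param_normal \<sigma> u = det (matrix (\<theta>' u)) *\<^sub>R param_normal \<psi> (\<theta> u)"
      by (rule param_normal_compose[OF \<theta>'[OF that] \<psi>_derivative \<sigma>'(1) that \<psi>\<theta>])
    then show ?thesis by (simp add: area_element_eq)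
  qed
  have "continuous_on U (area_element \<sigma>)"
  proof -
    have "area_element \<sigma> u = norm (cross3 (D u (axis 1 1)) (D u (axis 2 1)))" if "u \<in> U" for u
      unfolding area_element_eq param_normal_eq[OF D(1)[OF that]] ..
    moreover have "continuous_on U (\<lambda>u. norm (cross3 (D u (axis 1 1)) (D u (axis 2 1))))"
      by (intro continuous_intros continuous_on_cross D)
    ultimately show ?thesis by (simp cong: continuous_on_cong)
  qed
  \<comment> \<open>Continuity of the area element is known on \<open>U\<close> only; the indicator
    makes it a globally measurable function without changing the integral over
    \<open>B\<close>.\<close>
  then have meas: "(\<lambda>u. indicator U u *\<^sub>R area_element \<sigma> u) \<in> borel_measurable borel"
    using \<sigma>'(1) by (intro borel_measurable_continuous_on_indicator) auto
  have "(\<integral>\<^sup>+u\<in>B. ennreal (indicator U u *\<^sub>R area_element \<sigma> u) \<partial>lborel)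
      = (\<integral>\<^sup>+w\<in>\<theta> ` B. ennreal (area_element \<psi> w) \<partial>lborel)"
  proof (rule nn_integral_change_of_variables_image)
    show "(\<theta> has_derivative \<theta>' u) (at u)" if "u \<in> B" for u using \<theta>' B that by auto
    show "inj_on \<theta> B" using \<open>inj_on \<theta> U\<close> B inj_on_subset by blast
    show "\<theta> ` A \<in> sets borel" if "A \<in> sets borel" "A \<subseteq> B" for A
      using img[of A] that B \<theta>_img[of A] measurable_sets[OF borel_measurable_\<psi>, of "\<sigma> ` A"] by auto
    show "indicator U u *\<^sub>R area_element \<sigma> u = \<bar>det (matrix (\<theta>' u))\<bar> * area_element \<psi> (\<theta> u)" if "u \<in> B" for u
      using area B that by auto
    show "area_element \<psi> \<in> borel_measurable borel" by (simp add: area_element_eq[abs_def])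
    show "0 \<le> area_element \<psi> x" for x by (simp add: area_element_eq)
  qed (use B meas in auto)
  moreover have "(\<integral>\<^sup>+u\<in>B. ennreal (indicator U u *\<^sub>R area_element \<sigma> u) \<partial>lborel) = (\<integral>\<^sup>+u\<in>B. ennreal (area_element \<sigma> u) \<partial>lborel)"
    using B(2) by (intro nn_integral_cong) (auto simp: indicator_def)
  moreover have "emeasure pushforward (\<sigma> ` B) = (\<integral>\<^sup>+w\<in>\<theta> ` B. ennreal (area_element \<psi> w) \<partial>lborel)"
    unfolding \<theta>_img[OF B(2)] using sub B(2) by (intro emeasure_pushforward img B) auto
  ultimately show ?thesis by simp
qed

lemma surface_measure_range: "surface_measure (range \<psi>) = pushforward"
  unfolding surface_measure_def
proof (rule the_equality)
  show "sets pushforward = sets (restrict_space borel (range \<psi>)) \<and>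
    (\<forall>U \<sigma> B. local_parametrization (range \<psi>) U \<sigma> \<longrightarrow> B \<in> sets borel \<longrightarrow> B \<subseteq> U \<longrightarrow>
       emeasure pushforward (\<sigma> ` B) = (\<integral>\<^sup>+u\<in>B. ennreal (area_element \<sigma> u) \<partial>lborel))"
    using local_parametrization_area by simp
next
  fix \<mu> :: "(real^3) measure"
  assume \<mu>: "sets \<mu> = sets (restrict_space borel (range \<psi>)) \<and>
    (\<forall>U \<sigma> B. local_parametrization (range \<psi>) U \<sigma> \<longrightarrow> B \<in> sets borel \<longrightarrow> B \<subseteq> U \<longrightarrow>
       emeasure \<mu> (\<sigma> ` B) = (\<integral>\<^sup>+u\<in>B. ennreal (area_element \<sigma> u) \<partial>lborel))"
  show "\<mu> = pushforward"
  proof (rule measure_eqI)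
    show "sets \<mu> = sets pushforward" using \<mu> by simp
    fix E assume "E \<in> sets \<mu>"
    then have E: "E \<in> sets borel" "E \<subseteq> range \<psi>"
      using \<mu> closed_range by (auto simp: sets_restrict_space_iff)
    have "\<psi> -` E \<in> sets borel" using measurable_sets[OF borel_measurable_\<psi> E(1)] by simp
    moreover have "\<psi> ` (\<psi> -` E) = E" using E(2) by auto
    ultimately show "emeasure \<mu> E = emeasure pushforward E"
      using \<mu>[THEN conjunct2, rule_format, OF local_parametrization_self, of "\<psi> -` E"]
        emeasure_pushforward[OF E] by simp
  qed
qed

text \<open>\<open>\<phi> \<circ> \<psi>\<close> vanishes near \<open>w\<close>, so the gradient is
  orthogonal to both columns of the derivative of \<open>\<psi>\<close>. By the triple product
  expansion its cross product with the normal is zero, which for nonzero vectors means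
  proportionality.\<close>

lemma euclid_grad_parallel:
  assumes \<phi>: "defining_function (range \<psi>) U \<phi>" "\<psi> w \<in> U"
  obtains c where "c \<noteq> 0" "euclid_grad \<phi> (\<psi> w) = c *\<^sub>R param_normal \<psi> w"
    and "\<And>v. frechet_derivative \<phi> (at (\<psi> w)) v = euclid_grad \<phi> (\<psi> w) \<bullet> v"
proof -
  let ?G = "euclid_grad \<phi> (\<psi> w)" and ?D = "frechet_derivative \<psi> (at w)"
  have U: "open U" "C2_on U \<phi>" "?G \<noteq> 0" "\<And>g. g \<in> range \<psi> \<Longrightarrow> g \<in> U \<Longrightarrow> \<phi> g = 0"
    using \<phi> unfolding defining_function_def by blast+
  then obtain \<phi>' where "(\<phi> has_derivative \<phi>') (at (\<psi> w))"
    using \<phi>(2) by (metis C2_onE)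
  then have diff: "\<phi> differentiable at (\<psi> w)"
    by (rule differentiableI)
  then have der: "(\<phi> has_derivative frechet_derivative \<phi> (at (\<psi> w))) (at (\<psi> w))"
    using frechet_derivative_works by blast
  note grad = euclid_grad_inner[OF diff]
  have "((\<lambda>w. \<phi> (\<psi> w)) has_derivative (\<lambda>v. ?G \<bullet> ?D v)) (at w)"
    using has_derivative_compose[OF \<psi>_derivative der] by (simp add: grad)
  moreover have "((\<lambda>w. \<phi> (\<psi> w)) has_derivative (\<lambda>v. 0)) (at w)"
  proof (rule has_derivative_transform_within_open[of "\<lambda>_. 0"])
    show "open (\<psi> -` U)" using U(1) continuous_\<psi>[of UNIV] by (simp add: open_vimage)
  qed (use \<phi>(2) U(4) in auto)
  ultimately have ortho: "?G \<bullet> ?D v = 0" for v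
    using has_derivative_unique by metis
  have "cross3 ?G (param_normal \<psi> w) = 0"
    unfolding param_normal_def Lagrange by (simp add: ortho)
  then have "collinear {0, param_normal \<psi> w, ?G}"
    by (simp add: cross_eq_0 insert_commute)
  then obtain c where "?G = c *\<^sub>R param_normal \<psi> w"
    using U(3) param_normal_nonzero unfolding collinear_lemma by blast
  moreover have "c \<noteq> 0" using calculation U(3) by auto
  ultimately show thesis using that grad by blast
qed

text \<open>Numerator and denominator are both homogeneous of degree one in the gradient up to sign,
  so the proportionality factor between gradient and normal cancels.\<close>

lemma density_quotient:
  assumes \<phi>: "defining_function (range \<psi>) U \<phi>" "\<psi> w \<in> U"
  shows "W \<phi> (\<psi> w) / norm (euclid_grad \<phi> (\<psi> w)) = hnorm (param_normal \<psi> w) (\<psi> w) / norm (param_normal \<psi> w)"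
proof -
  obtain c where c: "c \<noteq> 0" "euclid_grad \<phi> (\<psi> w) = c *\<^sub>R param_normal \<psi> w"
    and grad: "\<And>v. frechet_derivative \<phi> (at (\<psi> w)) v = euclid_grad \<phi> (\<psi> w) \<bullet> v"
    using euclid_grad_parallel[OF \<phi>] by blast
  have "W \<phi> (\<psi> w) = sqrt (c\<^sup>2 * ((param_normal \<psi> w \<bullet> X1 (\<psi> w))\<^sup>2 + (param_normal \<psi> w \<bullet> X2 (\<psi> w))\<^sup>2))"
    unfolding W_def apply_field_def grad c(2) by (simp add: power_mult_distrib algebra_simps)
  also have "\<dots> = \<bar>c\<bar> * hnorm (param_normal \<psi> w) (\<psi> w)"
    by (simp add: real_sqrt_mult hnorm_def)
  finally show ?thesis using c by simp
qed

text \<open>The description of the density quantifies over defining functions; at a point without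
  any, every number would satisfy it. The assumption supplies one at each point and thereby makes
  the value unique.\<close>

lemma H_perimeter_density_\<psi>:
  assumes "\<And>w. \<exists>U \<phi>. \<psi> w \<in> U \<and> defining_function (range \<psi>) U \<phi>"
  shows "H_perimeter_density (range \<psi>) (\<psi> w) = hnorm (param_normal \<psi> w) (\<psi> w) / norm (param_normal \<psi> w)"
  unfolding H_perimeter_density_def
proof (rule the_equality)
  show "\<forall>U \<phi>. \<psi> w \<in> U \<and> defining_function (range \<psi>) U \<phi> \<longrightarrow>
      hnorm (param_normal \<psi> w) (\<psi> w) / norm (param_normal \<psi> w) = W \<phi> (\<psi> w) / norm (euclid_grad \<phi> (\<psi> w))"
    using density_quotient by metis
  show "v = hnorm (param_normal \<psi> w) (\<psi> w) / norm (param_normal \<psi> w)"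
    if "\<forall>U \<phi>. \<psi> w \<in> U \<and> defining_function (range \<psi>) U \<phi> \<longrightarrow> v = W \<phi> (\<psi> w) / norm (euclid_grad \<phi> (\<psi> w))" for v
    using that assms[of w] density_quotient by metis
qed

text \<open>The area element is the norm of the normal, which is also the denominator of the
  density; their product leaves \<open>hnorm\<close> alone.\<close>

lemma emeasure_H_perimeter:
  assumes def_fn: "\<And>w. \<exists>U \<phi>. \<psi> w \<in> U \<and> defining_function (range \<psi>) U \<phi>"
    and E: "E \<in> sets borel"
  shows "emeasure (H_perimeter_measure (range \<psi>)) (\<psi> ` E)
    = (\<integral>\<^sup>+w\<in>E. ennreal (hnorm (param_normal \<psi> w) (\<psi> w)) \<partial>lborel)"
proof -
  let ?h = "\<lambda>w. hnorm (param_normal \<psi> w) (\<psi> w) / norm (param_normal \<psi> w)"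
  have "continuous_on UNIV ?h"
    using param_normal_nonzero
    by (intro continuous_intros continuous_hnorm continuous_param_normal continuous_\<psi>) auto
  then have [measurable]: "?h \<in> borel_measurable borel"
    by (rule borel_measurable_continuous_onI)
  \<comment> \<open>On the range the density equals \<open>?h \<circ> \<rho>\<close>, which is how
    it acquires measurability.\<close>
  have "(\<lambda>g. ?h (\<rho> g)) \<in> borel_measurable (restrict_space borel (range \<psi>))"
    by (intro measurable_restrict_space1) measurable
  then have meas: "H_perimeter_density (range \<psi>) \<in> borel_measurable (restrict_space borel (range \<psi>))"
    by (rule measurable_cong[THEN iffD1, rotated])
       (auto simp: space_restrict_space H_perimeter_density_\<psi>[OF def_fn])
  have sets: "\<psi> ` E \<in> sets (restrict_space borel (range \<psi>))"
  proof -
    have "\<psi> ` E = range \<psi> \<inter> \<rho> -` E" by force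
    moreover have "\<rho> -` E \<in> sets borel" using measurable_sets[OF borel_measurable_\<rho> E] by simp
    ultimately show ?thesis by (auto simp: sets_restrict_space)
  qed
  have "emeasure (H_perimeter_measure (range \<psi>)) (\<psi> ` E)
      = (\<integral>\<^sup>+g\<in>\<psi> ` E. ennreal (H_perimeter_density (range \<psi>) g) \<partial>pushforward)"
    unfolding H_perimeter_measure_def surface_measure_range
    using meas sets by (intro emeasure_density) (auto simp: pushforward_def)
  also have "\<dots> = (\<integral>\<^sup>+w. ennreal (H_perimeter_density (range \<psi>) (\<psi> w)) * indicator (\<psi> ` E) (\<psi> w)
      \<partial>density lborel (\<lambda>w. ennreal (area_element \<psi> w)))"
    unfolding pushforward_def using meas sets
    by (intro nn_integral_distr) auto
  also have "\<dots> = (\<integral>\<^sup>+w. ennreal (?h w) * indicator E w \<partial>density lborel (\<lambda>w. ennreal (area_element \<psi> w)))"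
  proof (rule nn_integral_cong)
    fix w
    have "\<psi> w \<in> \<psi> ` E \<longleftrightarrow> w \<in> E" by (metis \<rho>_\<psi> imageE imageI)
    then show "ennreal (H_perimeter_density (range \<psi>) (\<psi> w)) * indicator (\<psi> ` E) (\<psi> w) = ennreal (?h w) * indicator E w"
      by (simp add: H_perimeter_density_\<psi>[OF def_fn] indicator_def)
  qed
  also have "\<dots> = (\<integral>\<^sup>+w. ennreal (area_element \<psi> w) * (ennreal (?h w) * indicator E w) \<partial>lborel)"
    using E by (intro nn_integral_density) (auto simp: area_element_eq)
  also have "\<dots> = (\<integral>\<^sup>+w\<in>E. ennreal (hnorm (param_normal \<psi> w) (\<psi> w)) \<partial>lborel)"
    using param_normal_nonzero
    by (intro nn_integral_cong)
       (auto simp: area_element_eq mult.assoc[symmetric] ennreal_mult'[symmetric] indicator_def)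
  finally show ?thesis .
qed

end

section \<open>Perturbations of the identity of the coordinate plane\<close>

definition pd :: "2 \<Rightarrow> (real^2 \<Rightarrow> real) \<Rightarrow> real^2 \<Rightarrow> real" where
  "pd i f w = frechet_derivative f (at w) (axis i 1)"

lemma C1_on_has_derivative_pd:
  assumes "C1_on UNIV f"
  shows "(f has_derivative (\<lambda>v. pd 1 f w * v$1 + pd 2 f w * v$2)) (at w)"
proof -
  have der: "(f has_derivative frechet_derivative f (at w)) (at w)"
    by (metis C1_onE assms UNIV_I differentiableI frechet_derivative_works)
  then interpret linear "frechet_derivative f (at w)" by (rule has_derivative_linear)
  have "frechet_derivative f (at w) v = pd 1 f w * v$1 + pd 2 f w * v$2" for v
    by (subst vec2_expand[of v]) (simp only: add scaleR pd_def, simp)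
  then have "frechet_derivative f (at w) = (\<lambda>v. pd 1 f w * v$1 + pd 2 f w * v$2)" by blast
  with der show ?thesis by simp
qed

lemma pd_eq: "(f has_derivative f') (at w) \<Longrightarrow> pd i f w = f' (axis i 1)"
  unfolding pd_def by (simp add: frechet_derivative_at[symmetric])

lemma C1_on_continuous_pd:
  assumes "C1_on UNIV f"
  shows "continuous_on A (pd i f)"
proof -
  obtain f' where f': "\<And>x. (f has_derivative blinfun_apply (f' x)) (at x)" "continuous_on UNIV f'"
    using assms unfolding C1_on_def by auto
  have "pd i f = (\<lambda>w. f' w (axis i 1))"
    using pd_eq[OF f'(1)] by auto
  then show ?thesis
    using continuous_on_subset[OF f'(2)] by (simp add: blinfun.continuous_on continuous_on_const)
qed

lemma C2_on_C1_pd: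
  assumes "C2_on UNIV f"
  shows "C1_on UNIV (pd i f)"
proof -
  obtain f' where f': "\<And>x. (f has_derivative f' x) (at x)" "\<And>v. C1_on UNIV (\<lambda>x. f' x v)"
    using assms by (metis C2_onE UNIV_I)
  have "pd i f = (\<lambda>w. f' w (axis i 1))"
    using pd_eq[OF f'(1)] by auto
  then show ?thesis using f'(2) by simp
qed

lemma pd_eq_0:
  assumes "closed C" "\<And>w. w \<notin> C \<Longrightarrow> f w = 0" "w \<notin> C"
  shows "pd i f w = 0"
proof -
  have "(f has_derivative (\<lambda>v. 0)) (at w)"
    by (rule has_derivative_transform_within_open[of "\<lambda>_. 0" _ _ UNIV "- C"]) (use assms in auto)
  then show ?thesis by (simp add: pd_eq)
qed

lemma compact_support_bounded:
  fixes g :: "'a::real_normed_vector \<Rightarrow> real"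
  assumes "compact C" "\<And>w. w \<notin> C \<Longrightarrow> g w = 0" "continuous_on UNIV g"
  obtains M where "M \<ge> 0" "\<And>w. \<bar>g w\<bar> \<le> M"
proof -
  have "bounded (g ` C)"
    using assms compact_continuous_image continuous_on_subset compact_imp_bounded by blast
  then obtain M where M: "\<And>w. w \<in> C \<Longrightarrow> \<bar>g w\<bar> \<le> M"
    unfolding bounded_iff by auto
  have "\<bar>g w\<bar> \<le> max M 0" for w
    using M[of w] assms(2)[of w] by (cases "w \<in> C") auto
  then show thesis using that[of "max M 0"] by simp
qed

lemma lipschitz_of_pd_bound:
  assumes f: "C1_on UNIV f" and M: "\<And>i w. \<bar>pd i f w\<bar> \<le> M"
  shows "\<bar>f x - f y\<bar> \<le> 2 * M * norm (x - y)"
proof -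
  have der: "(f has_derivative (\<lambda>v. pd 1 f w * v$1 + pd 2 f w * v$2)) (at w within UNIV)" for w
    using C1_on_has_derivative_pd[OF f] by simp
  \<comment> \<open>The factor 2 counts the partial derivatives, each bounded by
    \<open>M\<close>.\<close>
  have "onorm (\<lambda>v :: real^2. pd 1 f w * v$1 + pd 2 f w * v$2) \<le> 2 * M" for w
  proof (rule onorm_le)
    fix v :: "real^2"
    have "\<bar>pd i f w * v$j\<bar> \<le> M * norm v" for i j
      unfolding abs_mult
      by (intro mult_mono M component_le_norm_cart order_trans[OF abs_ge_zero M]) auto
    from this[of 1 1] this[of 2 2] show "norm (pd 1 f w * v$1 + pd 2 f w * v$2) \<le> 2 * M * norm v"
      by simp
  qed
  from differentiable_bound[OF convex_UNIV der this UNIV_I UNIV_I] show ?thesis by simp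
qed

definition vec2 :: "real \<Rightarrow> real \<Rightarrow> real^2" where
  "vec2 x y = x *\<^sub>R axis 1 1 + y *\<^sub>R axis 2 1"

lemma vec2_nth [simp]: "vec2 x y $ 1 = x" "vec2 x y $ 2 = y"
  by (simp_all add: vec2_def axis_def)

lemma vec2_eq_iff: "(v :: real^2) = w \<longleftrightarrow> v$1 = w$1 \<and> v$2 = w$2"
  by (simp add: vec_eq_iff forall_2)

lemma C1_on_vec2: "C1_on U f \<Longrightarrow> C1_on U g \<Longrightarrow> C1_on U (\<lambda>x. vec2 (f x) (g x))"
  unfolding vec2_def by (intro C1_on_add C1_on_linear_compose[OF bounded_linear_scaleR_left])

lemma norm_vec2_le: "norm (vec2 x y) \<le> \<bar>x\<bar> + \<bar>y\<bar>"
  unfolding vec2_def by (rule order_trans[OF norm_triangle_ineq]) simp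

text \<open>With \<open>\<bar>s\<bar> * M \<le> 1 / 8\<close>, each component of the displacement
  has Lipschitz constant at most 1/4, hence the displacement at most 1/2, and the perturbed map is a
  global bijection by contraction. The same bound keeps the Jacobian at least 49/64 - 1/64, so the
  inverse is as smooth as the map.\<close>

lemma perturbed_identity_inverse:
  assumes h: "C2_on UNIV h" and m: "C2_on UNIV m"
    and M: "M \<ge> 0" "\<And>i w. \<bar>pd i h w\<bar> \<le> M" "\<And>i w. \<bar>pd i m w\<bar> \<le> M"
    and s: "\<bar>s\<bar> * M \<le> 1 / 8"
  obtains \<zeta> where "C2_on UNIV \<zeta>"
    and "\<And>w. \<zeta> (vec2 (w$1 + s * h w) (w$2 + s * m w)) = w"
    and "\<And>y. vec2 (\<zeta> y $ 1 + s * h (\<zeta> y)) (\<zeta> y $ 2 + s * m (\<zeta> y)) = y"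
proof -
  define \<eta> where "\<eta> w = vec2 (w$1 + s * h w) (w$2 + s * m w)" for w
  define k where "k w = vec2 (s * h w) (s * m w)" for w
  have \<eta>_k: "\<eta> w = w + k w" for w by (simp add: \<eta>_def k_def vec2_eq_iff)
  note C1h = C2_on_imp_C1_on[OF h] and C1m = C2_on_imp_C1_on[OF m]
  have k_lip: "norm (k x - k y) \<le> 1/2 * norm (x - y)" for x y
  proof -
    have *: "\<bar>s * (u x - u y)\<bar> \<le> 1/4 * norm (x - y)" if "\<bar>u x - u y\<bar> \<le> 2 * M * norm (x - y)" for u :: "real^2 \<Rightarrow> real"
    proof -
      have "\<bar>s * (u x - u y)\<bar> \<le> \<bar>s\<bar> * (2 * M * norm (x - y))"
        using that by (simp add: abs_mult mult_left_mono)
      also have "\<dots> = 2 * (\<bar>s\<bar> * M) * norm (x - y)" by simp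
      also have "\<dots> \<le> 2 * (1/8) * norm (x - y)"
        using s by (intro mult_right_mono) auto
      finally show ?thesis by simp
    qed
    have "k x - k y = vec2 (s * (h x - h y)) (s * (m x - m y))"
      by (simp add: k_def vec2_eq_iff algebra_simps)
    then show ?thesis
      using norm_vec2_le[of "s * (h x - h y)" "s * (m x - m y)"]
        *[OF lipschitz_of_pd_bound[OF C1h M(2)]] *[OF lipschitz_of_pd_bound[OF C1m M(3)]] by simp
  qed
  \<comment> \<open>Solving \<open>\<eta> w = y\<close> amounts to finding a fixed point of
    \<open>w \<mapsto> y - k w\<close>.\<close>
  have ex1: "\<exists>!w. \<eta> w = y" for y
  proof -
    have "\<exists>!w. y - k w = w"
      by (rule banach_fix_type[of "1/2"]) (use k_lip in \<open>auto simp: dist_norm norm_minus_commute\<close>)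
    moreover have "y - k w = w \<longleftrightarrow> \<eta> w = y" for w by (auto simp: \<eta>_k algebra_simps)
    ultimately show ?thesis by simp
  qed
  define \<zeta> where "\<zeta> y = (THE w. \<eta> w = y)" for y
  have \<eta>\<zeta>: "\<eta> (\<zeta> y) = y" for y
    unfolding \<zeta>_def by (rule theI'[OF ex1])
  have \<zeta>\<eta>: "\<zeta> (\<eta> w) = w" for w
    using ex1[of "\<eta> w"] \<eta>\<zeta>[of "\<eta> w"] by blast
  have \<zeta>_lip: "norm (\<zeta> x - \<zeta> y) \<le> 2 * norm (x - y)" for x y
  proof -
    have "\<zeta> x - \<zeta> y = (x - y) - (k (\<zeta> x) - k (\<zeta> y))"
      using \<eta>\<zeta>[of x] \<eta>\<zeta>[of y] unfolding \<eta>_k by (simp add: algebra_simps)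
    then have "norm (\<zeta> x - \<zeta> y) \<le> norm (x - y) + norm (k (\<zeta> x) - k (\<zeta> y))"
      by (metis norm_triangle_ineq4)
    with k_lip[of "\<zeta> x" "\<zeta> y"] show ?thesis by simp
  qed
  \<comment> \<open>Continuity of the inverse is needed before its differentiability can be
    derived.\<close>
  have "2-lipschitz_on UNIV \<zeta>"
    by (rule lipschitz_onI) (use \<zeta>_lip in \<open>auto simp: dist_norm\<close>)
  then have cont: "continuous_on A \<zeta>" for A
    using lipschitz_on_continuous_on continuous_on_subset by blast
  define j11 where "j11 w = 1 + s * pd 1 h w" for w
  define j12 where "j12 w = s * pd 2 h w" for w
  define j21 where "j21 w = s * pd 1 m w" for w
  define j22 where "j22 w = 1 + s * pd 2 m w" for w
  define \<Delta> where "\<Delta> w = j11 w * j22 w - j12 w * j21 w" for w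
  have small: "\<bar>s * pd i u w\<bar> \<le> 1/8" if "\<And>i w. \<bar>pd i u w\<bar> \<le> M" for i u w
    using that[of i w] mult_left_mono[OF that[of i w] abs_ge_zero[of s]] s by (simp add: abs_mult)
  have \<Delta>: "\<Delta> w > 0" for w
  proof -
    have "j11 w \<ge> 7/8" "j22 w \<ge> 7/8" "\<bar>j12 w\<bar> \<le> 1/8" "\<bar>j21 w\<bar> \<le> 1/8"
      using small[OF M(2), of 1 w] small[OF M(3), of 2 w] small[OF M(2), of 2 w] small[OF M(3), of 1 w]
      unfolding j11_def j22_def j12_def j21_def by linarith+
    then have "j11 w * j22 w \<ge> 7/8 * (7/8)" "\<bar>j12 w * j21 w\<bar> \<le> 1/8 * (1/8)"
      unfolding abs_mult by (intro mult_mono; simp)+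
    then show ?thesis unfolding \<Delta>_def by auto
  qed
  have C1j: "C1_on UNIV j11" "C1_on UNIV j12" "C1_on UNIV j21" "C1_on UNIV j22"
    unfolding j11_def j12_def j21_def j22_def
    by (intro C1_on_add C1_on_mult C1_on_const C2_on_C1_pd h m)+
  have C1\<Delta>: "C1_on UNIV \<Delta>"
    unfolding \<Delta>_def by (intro C1_on_diff C1_on_mult C1j)
  define \<eta>' where "\<eta>' w v = vec2 (j11 w * v$1 + j12 w * v$2) (j21 w * v$1 + j22 w * v$2)" for w v :: "real^2"
  have \<eta>': "(\<eta> has_derivative \<eta>' w) (at w)" for w
    unfolding \<eta>_def \<eta>'_def vec2_def j11_def j12_def j21_def j22_def
    by (rule derivative_eq_intros C1_on_has_derivative_pd[OF C1h] C1_on_has_derivative_pd[OF C1m]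
        bounded_linear.has_derivative[OF bounded_linear_vec_nth] refl)+
       (simp add: algebra_simps)
  define \<zeta>' where "\<zeta>' y v = vec2 ((j22 (\<zeta> y) * v$1 - j12 (\<zeta> y) * v$2) / \<Delta> (\<zeta> y))
      ((j11 (\<zeta> y) * v$2 - j21 (\<zeta> y) * v$1) / \<Delta> (\<zeta> y))" for y v :: "real^2"
  have \<zeta>': "(\<zeta> has_derivative \<zeta>' y) (at y)" for y
  proof (rule has_derivative_inverse_basic[OF \<eta>' _ _ _ open_UNIV UNIV_I])
    have "linear (\<zeta>' y)"
      by (rule linearI) (simp_all add: \<zeta>'_def vec2_eq_iff add_divide_distrib[symmetric] algebra_simps)
    then show "bounded_linear (\<zeta>' y)" by (simp add: linear_conv_bounded_linear)
    show "\<zeta>' y \<circ> \<eta>' (\<zeta> y) = id"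
    proof
      fix v :: "real^2"
      let ?w = "\<zeta> y"
      have "(j22 ?w * (j11 ?w * v$1 + j12 ?w * v$2) - j12 ?w * (j21 ?w * v$1 + j22 ?w * v$2)) = \<Delta> ?w * v$1"
        "(j11 ?w * (j21 ?w * v$1 + j22 ?w * v$2) - j21 ?w * (j11 ?w * v$1 + j12 ?w * v$2)) = \<Delta> ?w * v$2"
        by (simp_all add: \<Delta>_def algebra_simps)
      then show "(\<zeta>' y \<circ> \<eta>' (\<zeta> y)) v = id v"
        using \<Delta>[of ?w] by (simp add: \<zeta>'_def \<eta>'_def vec2_eq_iff)
    qed
    show "isCont \<zeta> y" using cont[of UNIV] continuous_on_eq_continuous_at by blast
  qed (use \<eta>\<zeta> in auto)
  have cont_compose: "continuous_on UNIV (\<lambda>y. u (\<zeta> y))" if "C1_on UNIV u" for u :: "real^2 \<Rightarrow> real"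
    by (rule continuous_on_compose2[OF C1_on_imp_continuous_on[OF that] cont]) auto
  \<comment> \<open>Bootstrap: the derivative of \<open>\<zeta>\<close> is built from C1 functions
    evaluated at \<open>\<zeta>\<close>. Continuity of \<open>\<zeta>\<close> makes this derivative
    continuous, so \<open>\<zeta>\<close> is C1; then the derivative is C1, so
    \<open>\<zeta>\<close> is C2.\<close>
  have C1\<zeta>: "C1_on UNIV \<zeta>"
  proof (rule C1_onI[OF \<zeta>'])
    show "continuous_on UNIV (\<lambda>y. \<zeta>' y i)" for i
      unfolding \<zeta>'_def vec2_def using \<Delta>
      by (intro continuous_intros cont_compose C1j C1\<Delta>) (auto simp: less_imp_neq[symmetric])
  qed
  have C1_comp: "C1_on UNIV (\<lambda>y. u (\<zeta> y))" if "C1_on UNIV u" for u :: "real^2 \<Rightarrow> real"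
    by (rule C1_on_compose[OF C1\<zeta> that]) auto
  have "C2_on UNIV \<zeta>"
  proof (rule C2_onI[OF \<zeta>'])
    show "C1_on UNIV (\<lambda>y. \<zeta>' y i)" for i
      unfolding \<zeta>'_def using \<Delta>
      by (intro C1_on_vec2 C1_on_divide C1_on_diff C1_on_mult C1_on_const C1_comp C1j C1\<Delta>)
         (auto simp: less_imp_neq[symmetric])
  qed
  with \<zeta>\<eta> \<eta>\<zeta> that show thesis unfolding \<eta>_def by blast
qed

section \<open>Perimeter of a deformed vertical plane\<close>

text \<open>Coordinates adapted to the plane when \<open>(a, b)\<close> has length 1:
  \<open>p\<close> along the unit normal, \<open>q\<close> along the horizontal tangent direction,
  \<open>r\<close> along the t-axis.\<close>

definition frame :: "real \<Rightarrow> real \<Rightarrow> real \<Rightarrow> real \<Rightarrow> real \<Rightarrow> real^3" where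
  "frame a b p q r = p *\<^sub>R vector [a, b, 0] + q *\<^sub>R vector [- b, a, 0] + r *\<^sub>R vector [0, 0, 1]"

lemma frame_nth [simp]:
  "frame a b p q r $ 1 = a * p - b * q" "frame a b p q r $ 2 = b * p + a * q" "frame a b p q r $ 3 = r"
  by (simp_all add: frame_def)

lemma vec3_eq_iff: "(v :: real^3) = w \<longleftrightarrow> v$1 = w$1 \<and> v$2 = w$2 \<and> v$3 = w$3"
  by (simp add: vec_eq_iff forall_3)

lemma has_derivative_frame:
  assumes "(P has_derivative P') F" "(Q has_derivative Q') F" "(R has_derivative R') F"
  shows "((\<lambda>x. frame a b (P x) (Q x) (R x)) has_derivative (\<lambda>v. frame a b (P' v) (Q' v) (R' v))) F"
  unfolding frame_def by (intro derivative_intros assms)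

lemma C1_on_frame:
  "C1_on U P \<Longrightarrow> C1_on U Q \<Longrightarrow> C1_on U R \<Longrightarrow> C1_on U (\<lambda>x. frame a b (P x) (Q x) (R x))"
  unfolding frame_def by (intro C1_on_add C1_on_linear_compose[OF bounded_linear_scaleR_left])

text \<open>For unit \<open>(a, b)\<close> the frame is orthonormal and positively oriented, so the
  cross product has its usual coordinate expression.\<close>

lemma cross3_frame:
  assumes "a\<^sup>2 + b\<^sup>2 = 1"
  shows "cross3 (frame a b p q r) (frame a b p' q' r')
    = frame a b (q * r' - r * q') (r * p' - p * r') (p * q' - q * p')"
proof -
  have "(a * p - b * q) * (b * p' + a * q') - (b * p + a * q) * (a * p' - b * q')
      = (a\<^sup>2 + b\<^sup>2) * (p * q' - q * p')"
    by (simp add: algebra_simps power2_eq_square)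
  then show ?thesis using assms
    by (simp add: vec3_eq_iff cross3_def algebra_simps)
qed

text \<open>Rotations about the t-axis preserve the form \<open>x y' - x' y\<close> and hence the
  group law. The rotated horizontal fields thus have the same shape in the coordinates
  \<open>p, q, r\<close> as \<open>X1, X2\<close> in \<open>x, y, t\<close>.\<close>

lemma hnorm_frame:
  assumes "a\<^sup>2 + b\<^sup>2 = 1"
  shows "hnorm (frame a b u v z) (frame a b p q r) = sqrt ((u - q / 2 * z)\<^sup>2 + (v + p / 2 * z)\<^sup>2)"
proof -
  let ?A = "u - q / 2 * z" and ?B = "v + p / 2 * z"
  have eq: "a * u - b * v - z * (b * p + a * q) / 2 = a * ?A - b * ?B"
    "b * u + a * v + z * (a * p - b * q) / 2 = b * ?A + a * ?B"
    by (simp_all add: field_simps)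
  have rot: "(a * A - b * B)\<^sup>2 + (b * A + a * B)\<^sup>2 = (a\<^sup>2 + b\<^sup>2) * (A\<^sup>2 + B\<^sup>2)" for A B
    by (simp add: algebra_simps power2_eq_square)
  show ?thesis using assms by (simp only: hnorm_components frame_nth eq rot) simp
qed

locale plane_variation =
  fixes a b \<gamma> :: real and f h m :: "real^2 \<Rightarrow> real" and C :: "(real^2) set"
  assumes unit: "a\<^sup>2 + b\<^sup>2 = 1"
    and C2: "C2_on UNIV f" "C2_on UNIV h" "C2_on UNIV m"
    and compact_C: "compact C"
    and outside_C: "\<And>w. w \<notin> C \<Longrightarrow> f w = 0" "\<And>w. w \<notin> C \<Longrightarrow> h w = 0" "\<And>w. w \<notin> C \<Longrightarrow> m w = 0"
begin

definition \<psi> :: "real \<Rightarrow> real^2 \<Rightarrow> real^3" where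
  "\<psi> s w = frame a b (\<gamma> + s * f w) (w$1 + s * h w) (w$2 + s * m w)"

text \<open>The components of the normal to \<open>\<psi> s\<close> along \<open>a X1 + b X2\<close> and \<open>- b X1 + a X2\<close>.\<close>

definition A :: "real \<Rightarrow> real^2 \<Rightarrow> real" where
  "A s w = (1 + s * pd 1 h w) * (1 + s * pd 2 m w) - s * pd 1 m w * (s * pd 2 h w)
     - (w$1 + s * h w) / 2 * (s * pd 1 f w * (s * pd 2 h w) - (1 + s * pd 1 h w) * (s * pd 2 f w))"

definition B :: "real \<Rightarrow> real^2 \<Rightarrow> real" where
  "B s w = s * pd 1 m w * (s * pd 2 f w) - s * pd 1 f w * (1 + s * pd 2 m w)
     + (\<gamma> + s * f w) / 2 * (s * pd 1 f w * (s * pd 2 h w) - (1 + s * pd 1 h w) * (s * pd 2 f w))"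

lemmas C1 = C2[THEN C2_on_imp_C1_on]

lemma C1_\<psi>: "C1_on UNIV (\<psi> s)"
  unfolding \<psi>_def
  by (intro C1_on_frame C1_on_add[OF C1_on_const] C1_on_add[OF C1_on_bounded_linear[OF bounded_linear_vec_nth]]
      C1_on_mult[OF C1_on_const] C1)

lemma \<psi>_derivative:
  "(\<psi> s has_derivative (\<lambda>v. frame a b (s * (pd 1 f w * v$1 + pd 2 f w * v$2))
      (v$1 + s * (pd 1 h w * v$1 + pd 2 h w * v$2)) (v$2 + s * (pd 1 m w * v$1 + pd 2 m w * v$2)))) (at w)"
proof -
  have comp: "((\<lambda>w. P w + s * u w) has_derivative (\<lambda>v. P' v + s * (pd 1 u w * v$1 + pd 2 u w * v$2))) (at w)"
    if "(P has_derivative P') (at w)" "C1_on UNIV u" for P P' and u :: "real^2 \<Rightarrow> real"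
    by (intro has_derivative_add has_derivative_mult_right C1_on_has_derivative_pd that)
  have "((\<lambda>w. \<gamma> + s * f w) has_derivative (\<lambda>v. s * (pd 1 f w * v$1 + pd 2 f w * v$2))) (at w)"
    using comp[OF has_derivative_const C1(1), of \<gamma>] by simp
  then show ?thesis
    unfolding \<psi>_def
    by (intro has_derivative_frame comp C1(2,3) bounded_linear_imp_has_derivative bounded_linear_vec_nth)
qed

lemma hnorm_\<psi>: "hnorm (param_normal (\<psi> s) w) (\<psi> s w) = sqrt ((A s w)\<^sup>2 + (B s w)\<^sup>2)"
proof -
  have "param_normal (\<psi> s) w = cross3 (frame a b (s * pd 1 f w) (1 + s * pd 1 h w) (s * pd 1 m w))
      (frame a b (s * pd 2 f w) (s * pd 2 h w) (1 + s * pd 2 m w))"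
    unfolding param_normal_eq[OF \<psi>_derivative] by (simp add: axis_def)
  then show ?thesis
    unfolding cross3_frame[OF unit] \<psi>_def by (simp add: hnorm_frame[OF unit] A_def B_def)
qed

lemma pd_bound:
  assumes "C1_on UNIV u" "\<And>w. w \<notin> C \<Longrightarrow> u w = 0"
  obtains M where "M \<ge> 0" "\<And>i w. \<bar>pd i u w\<bar> \<le> M"
proof -
  have "\<exists>M\<ge>0. \<forall>w. \<bar>pd i u w\<bar> \<le> M" for i
    using compact_support_bounded[OF compact_C pd_eq_0[OF compact_imp_closed[OF compact_C] assms(2)]
        C1_on_continuous_pd[OF assms(1)]] by blast
  then obtain M where M: "\<And>i. M i \<ge> 0" "\<And>i w. \<bar>pd i u w\<bar> \<le> M i" by metis
  show thesis
  proof (rule that[of "M 1 + M 2"])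
    show "\<bar>pd i u w\<bar> \<le> M 1 + M 2" for i w
      using exhaust_2[of i] M(1)[of 1] M(1)[of 2] M(2)[of i w] by auto
  qed (use M(1) in \<open>auto intro: add_nonneg_nonneg\<close>)
qed

text \<open>\<open>\<epsilon>\<close> only has to keep the tangential displacement invertible. It
  depends on derivative bounds of \<open>h\<close> and \<open>m\<close> alone and serves all Borel
  sets \<open>E\<close>; the normal displacement \<open>f\<close> just changes the height of the
  graph.\<close>

lemma perimeter_formula:
  obtains \<epsilon> where "\<epsilon> > 0"
    and "\<And>s E. \<bar>s\<bar> < \<epsilon> \<Longrightarrow> E \<in> sets borel \<Longrightarrow>
      emeasure (H_perimeter_measure (range (\<psi> s))) (\<psi> s ` E)
        = (\<integral>\<^sup>+w\<in>E. ennreal (sqrt ((A s w)\<^sup>2 + (B s w)\<^sup>2)) \<partial>lborel)"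
proof -
  obtain Mh where Mh: "Mh \<ge> 0" "\<And>i w. \<bar>pd i h w\<bar> \<le> Mh" using pd_bound C1(2) outside_C(2) by blast
  obtain Mm where Mm: "Mm \<ge> 0" "\<And>i w. \<bar>pd i m w\<bar> \<le> Mm" using pd_bound C1(3) outside_C(3) by blast
  \<comment> \<open>The summand 1 makes \<open>M\<close> strictly positive, as the quotient
    \<open>1 / (8 * M)\<close> requires.\<close>
  define M where "M = 1 + Mh + Mm"
  have M: "M > 0" "\<And>i w. \<bar>pd i h w\<bar> \<le> M" "\<And>i w. \<bar>pd i m w\<bar> \<le> M"
    using Mh(1) Mm(1) order_trans[OF Mh(2), of "1 + Mh + Mm"] order_trans[OF Mm(2), of "1 + Mh + Mm"]
    unfolding M_def by auto
  show thesis
  proof (rule that[of "1 / (8 * M)"])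
    show "1 / (8 * M) > 0" using M by simp
    fix s E assume s: "\<bar>s\<bar> < 1 / (8 * M)" and E: "(E :: (real^2) set) \<in> sets borel"
    have "\<bar>s\<bar> * M \<le> 1 / 8" using s M(1) by (simp add: field_simps)
    then obtain \<zeta> where \<zeta>: "C2_on UNIV \<zeta>"
      and \<zeta>\<eta>: "\<And>w. \<zeta> (vec2 (w$1 + s * h w) (w$2 + s * m w)) = w"
      and \<eta>\<zeta>: "\<And>y. vec2 (\<zeta> y $ 1 + s * h (\<zeta> y)) (\<zeta> y $ 2 + s * m (\<zeta> y)) = y"
      using perturbed_identity_inverse[OF C2(2,3) _ M(2,3)] M(1) by (metis less_imp_le)
    \<comment> \<open>\<open>\<pi>\<close> reads off the tangential coordinates and
      \<open>\<zeta>\<close> undoes the tangential displacement, so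
      \<open>\<zeta> \<circ> \<pi>\<close> recovers the parameter from the deformed point.\<close>
    define \<pi> :: "real^3 \<Rightarrow> real^2" where "\<pi> g = vec2 (a * g$2 - b * g$1) (g$3)" for g
    \<comment> \<open>Equation of the graph: normal coordinate of the point minus the height
      prescribed over its tangential position.\<close>
    define \<phi> where "\<phi> g = (a * g$1 + b * g$2 - \<gamma>) + (- s) * f (\<zeta> (\<pi> g))" for g :: "real^3"
    have \<pi>: "bounded_linear \<pi>"
      unfolding \<pi>_def vec2_def by (intro bounded_linear_intros bounded_linear_vec_nth)
    have unit': "a * a + b * b = 1" using unit by (simp add: power2_eq_square)
    have \<pi>_frame: "\<pi> (frame a b p q r) = vec2 q r" for p q r
    proof -
      have "a * (b * p + a * q) - b * (a * p - b * q) = (a * a + b * b) * q" by (simp add: algebra_simps)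
      then show ?thesis by (simp add: \<pi>_def unit')
    qed
    have cn_frame: "a * frame a b p q r $ 1 + b * frame a b p q r $ 2 = p" for p q r
    proof -
      have "a * (a * p - b * q) + b * (b * p + a * q) = (a * a + b * b) * p" by (simp add: algebra_simps)
      then show ?thesis by (simp add: unit')
    qed
    have frame_surj: "g = frame a b (a * g$1 + b * g$2) (\<pi> g $ 1) (\<pi> g $ 2)" for g
    proof -
      have "a * (a * g$1 + b * g$2) - b * (a * g$2 - b * g$1) = (a * a + b * b) * g$1"
        "b * (a * g$1 + b * g$2) + a * (a * g$2 - b * g$1) = (a * a + b * b) * g$2"
        by (simp_all add: algebra_simps)
      then show ?thesis by (simp add: vec3_eq_iff \<pi>_def unit')
    qed
    interpret C1_chart "\<psi> s" "\<lambda>g. \<zeta> (\<pi> g)"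
    proof
      show "C1_on UNIV (\<lambda>g. \<zeta> (\<pi> g))"
        by (rule C1_on_compose[OF C1_on_bounded_linear[OF \<pi>] C2_on_imp_C1_on[OF \<zeta>]]) auto
    qed (simp_all add: C1_\<psi> \<psi>_def \<pi>_frame \<zeta>\<eta>)
    have f\<zeta>: "C2_on UNIV (\<lambda>y. f (\<zeta> y))"
      by (rule C2_on_compose[OF \<zeta> C2(1)]) auto
    have C2_f\<zeta>\<pi>: "C2_on UNIV (\<lambda>g. f (\<zeta> (\<pi> g)))"
      by (rule C2_on_compose[OF C2_on_bounded_linear[OF \<pi>] f\<zeta>]) auto
    have lin: "bounded_linear (\<lambda>g :: real^3. a * g$1 + b * g$2)"
      by (intro bounded_linear_intros bounded_linear_vec_nth)
    have C2_\<phi>: "C2_on UNIV \<phi>"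
      unfolding \<phi>_def diff_conv_add_uminus[of _ \<gamma>]
      by (intro C2_on_add C2_on_mult C2_on_const C2_f\<zeta>\<pi> C2_on_bounded_linear lin)
    have grad: "euclid_grad \<phi> g \<noteq> 0" for g
    proof
      assume 0: "euclid_grad \<phi> g = 0"
      obtain D where D: "((\<lambda>y. f (\<zeta> y)) has_derivative D) (at (\<pi> g))"
        using C1_on_has_derivative_pd[OF C2_on_imp_C1_on[OF f\<zeta>]] by blast
      have "((\<lambda>g. f (\<zeta> (\<pi> g))) has_derivative (\<lambda>v. D (\<pi> v))) (at g)"
        by (rule has_derivative_compose[OF bounded_linear_imp_has_derivative[OF \<pi>] D])
      then have \<phi>': "(\<phi> has_derivative (\<lambda>v. (a * v$1 + b * v$2 - 0) + (- s) * D (\<pi> v))) (at g)"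
        unfolding \<phi>_def
        by (intro has_derivative_add has_derivative_diff has_derivative_const has_derivative_mult_right
            bounded_linear_imp_has_derivative[OF lin])
      \<comment> \<open>The gradient is tested on the unit normal of the plane. \<open>\<pi>\<close>
        annihilates that direction, so the term with \<open>f\<close> does not contribute and the
        derivative is 1.\<close>
      from euclid_grad_inner[OF differentiableI[OF \<phi>'], of "frame a b 1 0 0"]
      have "a * frame a b 1 0 0 $ 1 + b * frame a b 1 0 0 $ 2 + (- s) * D (\<pi> (frame a b 1 0 0)) = 0"
        unfolding frechet_derivative_at[OF \<phi>', symmetric] 0 by simp
      moreover have "\<pi> (frame a b 1 0 0) = 0" by (simp add: \<pi>_frame vec2_eq_iff)
      moreover have "D 0 = 0" using D has_derivative_linear linear_0 by blast
      ultimately show False unfolding cn_frame by simp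
    qed
    have range: "range (\<psi> s) = {g. \<phi> g = 0}"
    proof (intro equalityI subsetI)
      fix g assume "g \<in> range (\<psi> s)"
      then obtain w where w: "g = \<psi> s w" by blast
      have "a * g$1 + b * g$2 = \<gamma> + s * f w" unfolding w \<psi>_def by (rule cn_frame)
      moreover have "\<zeta> (\<pi> g) = w" unfolding w by simp
      ultimately show "g \<in> {g. \<phi> g = 0}" by (simp add: \<phi>_def)
    next
      fix g assume "g \<in> {g. \<phi> g = 0}"
      then have "a * g$1 + b * g$2 = \<gamma> + s * f (\<zeta> (\<pi> g))" by (simp add: \<phi>_def)
      moreover have "\<pi> g $ 1 = \<zeta> (\<pi> g) $ 1 + s * h (\<zeta> (\<pi> g))" "\<pi> g $ 2 = \<zeta> (\<pi> g) $ 2 + s * m (\<zeta> (\<pi> g))"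
        using \<eta>\<zeta>[of "\<pi> g"] unfolding vec2_eq_iff by simp_all
      ultimately have "g = \<psi> s (\<zeta> (\<pi> g))" unfolding \<psi>_def using frame_surj[of g] by simp
      then show "g \<in> range (\<psi> s)" by (metis rangeI)
    qed
    have "defining_function (range (\<psi> s)) UNIV \<phi>"
      unfolding defining_function_def using C2_\<phi> grad range by simp
    then show "emeasure (H_perimeter_measure (range (\<psi> s))) (\<psi> s ` E)
        = (\<integral>\<^sup>+w\<in>E. ennreal (sqrt ((A s w)\<^sup>2 + (B s w)\<^sup>2)) \<partial>lborel)"
      using emeasure_H_perimeter[OF _ E] unfolding hnorm_\<psi> by blast
  qed
qed

end

section \<open>Integrals of derivatives of compactly supported functions\<close>

lemma integral_cbox_eq_UNIV:
  fixes g :: "'a::euclidean_space \<Rightarrow> real"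
  assumes "\<And>w. w \<notin> cbox p q \<Longrightarrow> g w = 0"
  shows "integral (cbox p q) g = integral UNIV g"
proof -
  have "g = (\<lambda>w. if w \<in> cbox p q then g w else 0)" using assms by auto
  then show ?thesis by (metis integral_restrict_UNIV)
qed

lemma integrable_UNIV_compact_support:
  fixes g :: "'a::euclidean_space \<Rightarrow> real"
  assumes "compact C" "\<And>w. w \<notin> C \<Longrightarrow> g w = 0" "continuous_on UNIV g"
  shows "g integrable_on UNIV"
proof -
  obtain p q where pq: "C \<subseteq> cbox p q"
    using bounded_subset_cbox_symmetric[OF compact_imp_bounded[OF assms(1)]] by blast
  then have "g integrable_on cbox p q"
    using assms(3) continuous_on_subset by (blast intro: integrable_continuous)
  moreover have "g w = 0" if "w \<notin> cbox p q" for w using assms(2) pq that by blast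
  then have "g = (\<lambda>w. if w \<in> cbox p q then g w else 0)" by auto
  ultimately show ?thesis by (metis integrable_restrict_UNIV)
qed

lemma integral_UNIV_translate:
  fixes g :: "'a::euclidean_space \<Rightarrow> real"
  assumes "compact C" "\<And>w. w \<notin> C \<Longrightarrow> g w = 0"
  shows "integral UNIV (\<lambda>w. g (w + c)) = integral UNIV g"
proof -
  obtain p q where pq: "C \<subseteq> cbox p q"
    using bounded_subset_cbox_symmetric[OF compact_imp_bounded[OF assms(1)]] by blast
  have "integral UNIV (\<lambda>w. g (w + c)) = integral (cbox (p - c) (q - c)) (\<lambda>w. g (w + c))"
  proof (rule integral_cbox_eq_UNIV[symmetric])
    fix w assume "w \<notin> cbox (p - c) (q - c)"
    then have "w + c \<notin> cbox p q" by (auto simp: mem_box algebra_simps)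
    then show "g (w + c) = 0" using assms(2) pq by blast
  qed
  also have "\<dots> = integral (cbox p q) g"
    by (rule integral_shift_cbox)
  also have "\<dots> = integral UNIV g"
    using assms(2) pq by (intro integral_cbox_eq_UNIV) blast
  finally show ?thesis .
qed

lemma DERIV_along_axis:
  assumes "C1_on UNIV F"
  shows "((\<lambda>t. F (w + t *\<^sub>R axis i 1)) has_real_derivative pd i F (w + t *\<^sub>R axis i 1)) (at t within U)"
proof -
  have "((\<lambda>t. w + t *\<^sub>R axis i 1) has_derivative (\<lambda>x. x *\<^sub>R axis i 1)) (at t within U)"
    by (auto intro!: derivative_eq_intros)
  from has_derivative_compose[OF this C1_on_has_derivative_pd[OF assms]]
  show ?thesis
    unfolding has_field_derivative_def
    by (rule has_derivative_eq_rhs) (use exhaust_2[of i] in \<open>auto simp: axis_def fun_eq_iff\<close>)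
qed

text \<open>Translating \<open>F\<close> and differentiating in the translation parameter produces
  its partial derivative under the integral. The factor \<open>V\<close> needs only continuity, so a
  first derivative of a C1 function may be inserted for it.\<close>

lemma DERIV_integral_translate:
  assumes F: "C1_on UNIV F" and V: "continuous_on UNIV V"
    and C: "compact C" "\<And>w. w \<notin> C \<Longrightarrow> F w = 0"
  shows "((\<lambda>t. integral UNIV (\<lambda>w. F (w + t *\<^sub>R axis i 1) * V w)) has_real_derivative
    integral UNIV (\<lambda>w. pd i F w * V w)) (at 0)"
proof -
  let ?e = "axis i (1::real) :: real^2"
  \<comment> \<open>The sum of \<open>C\<close> with the unit ball contains the supports of all
    translates with \<open>\<bar>t\<bar> \<le> 1\<close>, so one box serves as a domain of
    integration independent of \<open>t\<close>.\<close>
  obtain p q where pq: "{x + y | x y. x \<in> C \<and> y \<in> cball 0 1} \<subseteq> cbox p q"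
    using bounded_subset_cbox_symmetric[OF compact_imp_bounded[OF compact_sums[OF C(1) compact_cball]]] by blast
  have zero: "F (w + t *\<^sub>R ?e) = 0" if "w \<notin> cbox p q" "\<bar>t\<bar> \<le> 1" for w t
  proof (rule ccontr)
    assume "F (w + t *\<^sub>R ?e) \<noteq> 0"
    then have "w + t *\<^sub>R ?e \<in> C" using C(2) by blast
    moreover have "- t *\<^sub>R ?e \<in> cball 0 1" using that by simp
    ultimately have "(w + t *\<^sub>R ?e) + (- t *\<^sub>R ?e) \<in> cbox p q" using pq by blast
    then show False using that by simp
  qed
  have pd0: "pd i F w = 0" if "w \<notin> cbox p q" for w
    by (rule pd_eq_0[OF closed_cbox _ that]) (use zero[of _ 0] in auto)
  have "((\<lambda>t. integral (cbox p q) (\<lambda>w. F (w + t *\<^sub>R ?e) * V w)) has_real_derivative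
    integral (cbox p q) (\<lambda>w. pd i F (w + 0 *\<^sub>R ?e) * V w)) (at 0 within {-1<..<1})"
  proof (rule leibniz_rule_field_derivative)
    show "((\<lambda>t. F (w + t *\<^sub>R ?e) * V w) has_real_derivative pd i F (w + t *\<^sub>R ?e) * V w) (at t within {-1<..<1})" for t w
      by (intro DERIV_cmult_right DERIV_along_axis F)
    show "(\<lambda>w. F (w + t *\<^sub>R ?e) * V w) integrable_on cbox p q" for t
      by (intro integrable_continuous continuous_intros continuous_on_compose2[OF C1_on_imp_continuous_on[OF F]]
          continuous_on_subset[OF V]) auto
    show "continuous_on ({-1<..<1} \<times> cbox p q) (\<lambda>(t, w). pd i F (w + t *\<^sub>R ?e) * V w)"
      unfolding split_beta
      by (intro continuous_intros continuous_on_compose2[OF C1_on_continuous_pd[OF F, of UNIV]]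
          continuous_on_compose2[OF V]) auto
  qed auto
  then have "((\<lambda>t. integral (cbox p q) (\<lambda>w. F (w + t *\<^sub>R ?e) * V w)) has_real_derivative
    integral (cbox p q) (\<lambda>w. pd i F w * V w)) (at 0)"
    using at_within_open[OF _ open_greaterThanLessThan, of 0 "-1" "1::real"] by simp
  moreover have "integral (cbox p q) (\<lambda>w. pd i F w * V w) = integral UNIV (\<lambda>w. pd i F w * V w)"
    by (rule integral_cbox_eq_UNIV) (simp add: pd0)
  ultimately have "((\<lambda>t. integral (cbox p q) (\<lambda>w. F (w + t *\<^sub>R ?e) * V w)) has_real_derivative
    integral UNIV (\<lambda>w. pd i F w * V w)) (at 0)" by simp
  \<comment> \<open>The two integrals agree only for \<open>\<bar>t\<bar> < 1\<close>, which is
    enough for a derivative at 0.\<close>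
  then show ?thesis
  proof (rule DERIV_cong_ev[THEN iffD1, rotated -1])
    have "\<forall>\<^sub>F t in nhds (0::real). \<bar>t\<bar> < 1"
      using eventually_nhds_in_open[of "{-1<..<1}" "0::real"] by (auto elim!: eventually_mono)
    then show "\<forall>\<^sub>F t in nhds 0. integral (cbox p q) (\<lambda>w. F (w + t *\<^sub>R ?e) * V w) = integral UNIV (\<lambda>w. F (w + t *\<^sub>R ?e) * V w)"
      by eventually_elim (auto intro!: integral_cbox_eq_UNIV simp: zero)
  qed auto
qed

text \<open>By translation invariance the integral of the translated function is constant in
  \<open>t\<close>, while its derivative at 0 is the integral of the partial derivative.\<close>

lemma integral_pd_zero:
  assumes F: "C1_on UNIV F" and C: "compact C" "\<And>w. w \<notin> C \<Longrightarrow> F w = 0"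
  shows "integral UNIV (pd i F) = 0"
proof -
  have "((\<lambda>t. integral UNIV (\<lambda>w. F (w + t *\<^sub>R axis i 1))) has_real_derivative integral UNIV (pd i F)) (at 0)"
    using DERIV_integral_translate[OF F continuous_on_const[of _ 1] C] by simp
  then have "((\<lambda>t::real. integral UNIV F) has_real_derivative integral UNIV (pd i F)) (at (0::real))"
    by (simp add: integral_UNIV_translate[where g=F, OF C])
  then show ?thesis using DERIV_unique DERIV_const by blast
qed

lemma pd_mult:
  assumes "C1_on UNIV F" "C1_on UNIV G"
  shows "pd i (\<lambda>w. F w * G w) w = F w * pd i G w + pd i F w * G w"
proof -
  have "((\<lambda>w. F w * G w) has_derivative (\<lambda>v. F w * (pd 1 G w * v$1 + pd 2 G w * v$2)
      + (pd 1 F w * v$1 + pd 2 F w * v$2) * G w)) (at w)"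
    by (intro has_derivative_mult C1_on_has_derivative_pd assms)
  from pd_eq[OF this, of i] show ?thesis
    using exhaust_2[of i] by (auto simp: axis_def)
qed

lemma pd_translate:
  assumes "C1_on UNIV F"
  shows "pd i (\<lambda>w. F (w + c)) w = pd i F (w + c)"
proof -
  have "((\<lambda>w. w + c) has_derivative (\<lambda>v. v)) (at w)"
    by (auto intro!: derivative_eq_intros)
  from has_derivative_compose[OF this C1_on_has_derivative_pd[OF assms]]
  have "pd i (\<lambda>w. F (w + c)) w = pd 1 F (w + c) * axis i 1 $ 1 + pd 2 F (w + c) * axis i 1 $ 2"
    by (rule pd_eq)
  then show ?thesis using exhaust_2[of i] by (auto simp: axis_def)
qed

lemma C1_on_translate: "C1_on UNIV F \<Longrightarrow> C1_on UNIV (\<lambda>w. F (w + c))"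
  by (rule C1_on_compose[where V=UNIV and f="\<lambda>w. w + c"])
     (auto intro: C1_on_add C1_on_bounded_linear[OF bounded_linear_ident])

text \<open>Translating \<open>F\<close> and integrating by parts once moves a derivative across without
  using the symmetry of second derivatives.\<close>

lemma integral_Jacobian_zero:
  assumes F: "C1_on UNIV F" and G: "C1_on UNIV G"
    and C: "compact C" "\<And>w. w \<notin> C \<Longrightarrow> F w = 0" "\<And>w. w \<notin> C \<Longrightarrow> G w = 0"
  shows "integral UNIV (\<lambda>w. pd 1 F w * pd 2 G w - pd 2 F w * pd 1 G w) = 0"
proof -
  let ?e = "axis 1 (1::real) :: real^2"
  note contF = C1_on_imp_continuous_on[OF F] and contG = C1_on_imp_continuous_on[OF G]
  have pdG: "pd i G w = 0" if "w \<notin> C" for i w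
    using pd_eq_0[OF compact_imp_closed[OF C(1)] C(3) that] .
  have pdF: "pd i F w = 0" if "w \<notin> C" for i w
    using pd_eq_0[OF compact_imp_closed[OF C(1)] C(2) that] .
  \<comment> \<open>Integration by parts in direction 2 moves the derivative from \<open>G\<close>
    to the translate of \<open>F\<close>; substituting in the integral then shifts the translation
    to \<open>G\<close>, with opposite sign.\<close>
  have swap: "integral UNIV (\<lambda>w. F (w + t *\<^sub>R ?e) * pd 2 G w) = - integral UNIV (\<lambda>w. G (w + (- t) *\<^sub>R ?e) * pd 2 F w)" for t
  proof -
    let ?Ft = "\<lambda>w. F (w + t *\<^sub>R ?e)"
    have Ft: "C1_on UNIV ?Ft" by (rule C1_on_translate[OF F])
    have "integral UNIV (pd 2 (\<lambda>w. ?Ft w * G w)) = 0"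
      by (rule integral_pd_zero[OF C1_on_mult[OF Ft G] C(1)]) (simp add: C)
    moreover have "pd 2 (\<lambda>w. ?Ft w * G w) = (\<lambda>w. ?Ft w * pd 2 G w + pd 2 F (w + t *\<^sub>R ?e) * G w)"
      using pd_mult[OF Ft G] pd_translate[OF F] by auto
    moreover have "(\<lambda>w. ?Ft w * pd 2 G w) integrable_on UNIV"
      by (rule integrable_UNIV_compact_support[OF C(1)])
         (auto simp: pdG intro!: continuous_intros C1_on_imp_continuous_on[OF Ft] C1_on_continuous_pd[OF G])
    moreover have "(\<lambda>w. pd 2 F (w + t *\<^sub>R ?e) * G w) integrable_on UNIV"
      by (rule integrable_UNIV_compact_support[OF C(1)])
         (auto simp: C intro!: continuous_intros contG continuous_on_compose2[OF C1_on_continuous_pd[OF F, of UNIV]])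
    ultimately have "integral UNIV (\<lambda>w. ?Ft w * pd 2 G w) = - integral UNIV (\<lambda>w. pd 2 F (w + t *\<^sub>R ?e) * G w)"
      using integral_add[of "\<lambda>w. ?Ft w * pd 2 G w" UNIV "\<lambda>w. pd 2 F (w + t *\<^sub>R ?e) * G w"] by simp
    moreover have "integral UNIV (\<lambda>w. pd 2 F (w + t *\<^sub>R ?e) * G (w + t *\<^sub>R ?e + (- t) *\<^sub>R ?e)) = integral UNIV (\<lambda>w. pd 2 F w * G (w + (- t) *\<^sub>R ?e))"
      by (rule integral_UNIV_translate[OF C(1), of "\<lambda>w. pd 2 F w * G (w + (- t) *\<^sub>R ?e)"]) (simp add: pdF)
    ultimately show ?thesis by (simp add: mult.commute)
  qed
  have "((\<lambda>t. integral UNIV (\<lambda>w. F (w + t *\<^sub>R ?e) * pd 2 G w)) has_real_derivative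
      integral UNIV (\<lambda>w. pd 1 F w * pd 2 G w)) (at 0)"
    by (rule DERIV_integral_translate[OF F C1_on_continuous_pd[OF G] C(1,2)])
  \<comment> \<open>The same function of \<open>t\<close> is differentiated a second time through
    \<open>swap\<close>. The sign from integration by parts cancels the one from replacing
    \<open>t\<close> by \<open>- t\<close>.\<close>
  moreover have "((\<lambda>t. integral UNIV (\<lambda>w. F (w + t *\<^sub>R ?e) * pd 2 G w)) has_real_derivative
      integral UNIV (\<lambda>w. pd 1 G w * pd 2 F w)) (at 0)"
  proof -
    let ?I = "\<lambda>t. integral UNIV (\<lambda>w. G (w + t *\<^sub>R ?e) * pd 2 F w)"
    have "(?I has_real_derivative integral UNIV (\<lambda>w. pd 1 G w * pd 2 F w)) (at (- 0))"
      using DERIV_integral_translate[OF G C1_on_continuous_pd[OF F] C(1,3), of 1 2] by simp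
    from DERIV_minus[OF DERIV_mirror[THEN iffD1, OF this]] show ?thesis unfolding swap by simp
  qed
  ultimately have "integral UNIV (\<lambda>w. pd 1 F w * pd 2 G w) = integral UNIV (\<lambda>w. pd 1 G w * pd 2 F w)"
    by (rule DERIV_unique)
  moreover have "(\<lambda>w. pd 1 F w * pd 2 G w) integrable_on UNIV" "(\<lambda>w. pd 2 F w * pd 1 G w) integrable_on UNIV"
    by (rule integrable_UNIV_compact_support[OF C(1)];
        auto simp: pdG intro!: continuous_intros C1_on_continuous_pd F G)+
  ultimately show ?thesis
    by (simp add: integral_diff mult.commute)
qed

section \<open>Differentiation of the perimeter\<close>

lemma DERIV_sqrt_sum_squares:
  assumes "(A has_real_derivative A') (at s within U)" "(B has_real_derivative B') (at s within U)"
    and "(A s)\<^sup>2 + (B s)\<^sup>2 > 0"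
  shows "((\<lambda>s. sqrt ((A s)\<^sup>2 + (B s)\<^sup>2)) has_real_derivative
    (A s * A' + B s * B') / sqrt ((A s)\<^sup>2 + (B s)\<^sup>2)) (at s within U)"
proof -
  have "((\<lambda>s. (A s)\<^sup>2 + (B s)\<^sup>2) has_real_derivative 2 * (A s * A' + B s * B')) (at s within U)"
    by (auto intro!: derivative_eq_intros assms(1,2))
  note der = DERIV_chain2[OF DERIV_real_sqrt[OF assms(3)] this]
  have "inverse r / 2 * (2 * z) = z / r" for r z :: real by (simp add: field_simps)
  from DERIV_cong[OF der this] show ?thesis .
qed

lemma DERIV_sqrt_sum_squares2:
  assumes "(A has_real_derivative A' s) (at s within U)" "(B has_real_derivative B' s) (at s within U)"
    and "(A' has_real_derivative A'') (at s within U)" "(B' has_real_derivative B'') (at s within U)"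
    and pos: "(A s)\<^sup>2 + (B s)\<^sup>2 > 0"
  shows "((\<lambda>s. (A s * A' s + B s * B' s) / sqrt ((A s)\<^sup>2 + (B s)\<^sup>2)) has_real_derivative
    (((A' s)\<^sup>2 + A s * A'' + ((B' s)\<^sup>2 + B s * B'')) * sqrt ((A s)\<^sup>2 + (B s)\<^sup>2)
      - (A s * A' s + B s * B' s) * ((A s * A' s + B s * B' s) / sqrt ((A s)\<^sup>2 + (B s)\<^sup>2)))
    / ((A s)\<^sup>2 + (B s)\<^sup>2)) (at s within U)"
proof -
  have num: "((\<lambda>s. A s * A' s + B s * B' s) has_real_derivative
      (A' s)\<^sup>2 + A s * A'' + ((B' s)\<^sup>2 + B s * B'')) (at s within U)"
    by (rule DERIV_cong[OF DERIV_add[OF DERIV_mult[OF assms(1,3)] DERIV_mult[OF assms(2,4)]]])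
       (simp add: power2_eq_square algebra_simps)
  have "sqrt ((A s)\<^sup>2 + (B s)\<^sup>2) * sqrt ((A s)\<^sup>2 + (B s)\<^sup>2) = (A s)\<^sup>2 + (B s)\<^sup>2" by simp
  with DERIV_divide[OF num DERIV_sqrt_sum_squares[OF assms(1,2) pos] less_imp_neq[OF real_sqrt_gt_zero[OF pos], symmetric]]
  show ?thesis by (simp only:)
qed

context plane_variation
begin

section \<open>Coefficients of the powers of \<open>s\<close> in \<open>A\<close> and
  \<open>B\<close>\<close>

definition A1 where "A1 w = pd 1 h w + pd 2 m w + w$1 / 2 * pd 2 f w"
definition A2 where "A2 w = pd 1 h w * pd 2 m w - pd 2 h w * pd 1 m w
  + (w$1 / 2 * (pd 1 h w * pd 2 f w - pd 2 h w * pd 1 f w) + h w / 2 * pd 2 f w)"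
definition A3 where "A3 w = h w / 2 * (pd 1 h w * pd 2 f w - pd 2 h w * pd 1 f w)"
text \<open>On the plane the horizontal tangent field \<open>- b X1 + a X2\<close> reads
  \<open>\<partial>1 + \<gamma>/2 \<partial>2\<close> in the coordinates \<open>w\<close>. So
  \<open>B1\<close> is minus the derivative of the normal displacement along this field.\<close>

definition B1 where "B1 w = - pd 1 f w - \<gamma> / 2 * pd 2 f w"
definition B2 where "B2 w = pd 1 m w * pd 2 f w - pd 2 m w * pd 1 f w
  - \<gamma> / 2 * (pd 1 h w * pd 2 f w - pd 2 h w * pd 1 f w) - f w / 2 * pd 2 f w"
definition B3 where "B3 w = - f w / 2 * (pd 1 h w * pd 2 f w - pd 2 h w * pd 1 f w)"

lemma A_expand: "A s w = 1 + s * A1 w + s\<^sup>2 * A2 w + s ^ 3 * A3 w"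
  by (simp add: A_def A1_def A2_def A3_def field_simps power2_eq_square power3_eq_cube)

lemma B_expand: "B s w = s * B1 w + s\<^sup>2 * B2 w + s ^ 3 * B3 w"
  by (simp add: B_def B1_def B2_def B3_def field_simps power2_eq_square power3_eq_cube)

lemma pd_outside_C:
  assumes "w \<notin> C"
  shows "pd i f w = 0" "pd i h w = 0" "pd i m w = 0"
  using pd_eq_0[OF compact_imp_closed[OF compact_C] outside_C(1) assms]
    pd_eq_0[OF compact_imp_closed[OF compact_C] outside_C(2) assms]
    pd_eq_0[OF compact_imp_closed[OF compact_C] outside_C(3) assms] by simp_all

lemma coeff_outside_C:
  assumes "w \<notin> C"
  shows "A1 w = 0" "A2 w = 0" "A3 w = 0" "B1 w = 0" "B2 w = 0" "B3 w = 0"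
  using pd_outside_C[OF assms] outside_C[OF assms]
  by (simp_all add: A1_def A2_def A3_def B1_def B2_def B3_def)

lemma continuous_coeff:
  "continuous_on U A1" "continuous_on U A2" "continuous_on U A3"
  "continuous_on U B1" "continuous_on U B2" "continuous_on U B3"
  unfolding A1_def A2_def A3_def B1_def B2_def B3_def
  by (auto intro!: continuous_intros C1_on_continuous_pd C1
      continuous_on_subset[OF C1_on_imp_continuous_on[OF C1(1)]]
      continuous_on_subset[OF C1_on_imp_continuous_on[OF C1(2)]])

section \<open>The perimeter integrand and its derivatives in \<open>s\<close>\<close>

definition L where "L s w = sqrt ((A s w)\<^sup>2 + (B s w)\<^sup>2)"

definition A' where "A' s w = A1 w + 2 * s * A2 w + 3 * s\<^sup>2 * A3 w"
definition A'' where "A'' s w = 2 * A2 w + 6 * s * A3 w"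
definition B' where "B' s w = B1 w + 2 * s * B2 w + 3 * s\<^sup>2 * B3 w"
definition B'' where "B'' s w = 2 * B2 w + 6 * s * B3 w"

definition L' where "L' s w = (A s w * A' s w + B s w * B' s w) / sqrt ((A s w)\<^sup>2 + (B s w)\<^sup>2)"
definition L'' where "L'' s w =
  (((A' s w)\<^sup>2 + A s w * A'' s w + ((B' s w)\<^sup>2 + B s w * B'' s w)) * sqrt ((A s w)\<^sup>2 + (B s w)\<^sup>2)
      - (A s w * A' s w + B s w * B' s w) * ((A s w * A' s w + B s w * B' s w) / sqrt ((A s w)\<^sup>2 + (B s w)\<^sup>2)))
    / ((A s w)\<^sup>2 + (B s w)\<^sup>2)"

lemma DERIV_AB:
  "((\<lambda>s. A s w) has_real_derivative A' s w) (at s within U)"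
  "((\<lambda>s. A' s w) has_real_derivative A'' s w) (at s within U)"
  "((\<lambda>s. B s w) has_real_derivative B' s w) (at s within U)"
  "((\<lambda>s. B' s w) has_real_derivative B'' s w) (at s within U)"
  unfolding A_expand B_expand A'_def A''_def B'_def B''_def
  by (auto intro!: derivative_eq_intros simp: power2_eq_square)

lemma DERIV_L:
  assumes "A s w > 0"
  shows "((\<lambda>s. L s w) has_real_derivative L' s w) (at s within U)"
    "((\<lambda>s. L' s w) has_real_derivative L'' s w) (at s within U)"
proof -
  have pos: "(A s w)\<^sup>2 + (B s w)\<^sup>2 > 0" using assms by (simp add: add_pos_nonneg)
  show "((\<lambda>s. L s w) has_real_derivative L' s w) (at s within U)"
    unfolding L_def L'_def by (rule DERIV_sqrt_sum_squares[OF DERIV_AB(1,3) pos])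
  show "((\<lambda>s. L' s w) has_real_derivative L'' s w) (at s within U)"
    unfolding L'_def L''_def by (rule DERIV_sqrt_sum_squares2[OF DERIV_AB(1,3,2,4) pos])
qed

lemma coeff_bound:
  obtains M where "M > 0" "\<And>w. \<bar>A1 w\<bar> \<le> M" "\<And>w. \<bar>A2 w\<bar> \<le> M" "\<And>w. \<bar>A3 w\<bar> \<le> M"
proof -
  obtain M1 where M1: "M1 \<ge> 0" "\<And>w. \<bar>A1 w\<bar> \<le> M1"
    using compact_support_bounded[OF compact_C coeff_outside_C(1) continuous_coeff(1)] by blast
  obtain M2 where M2: "M2 \<ge> 0" "\<And>w. \<bar>A2 w\<bar> \<le> M2"
    using compact_support_bounded[OF compact_C coeff_outside_C(2) continuous_coeff(2)] by blast
  obtain M3 where M3: "M3 \<ge> 0" "\<And>w. \<bar>A3 w\<bar> \<le> M3"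
    using compact_support_bounded[OF compact_C coeff_outside_C(3) continuous_coeff(3)] by blast
  show thesis
  proof (rule that[of "1 + M1 + M2 + M3"])
    show "\<bar>A1 w\<bar> \<le> 1 + M1 + M2 + M3" for w using M1(2)[of w] M1(1) M2(1) M3(1) by linarith
    show "\<bar>A2 w\<bar> \<le> 1 + M1 + M2 + M3" for w using M2(2)[of w] M1(1) M2(1) M3(1) by linarith
    show "\<bar>A3 w\<bar> \<le> 1 + M1 + M2 + M3" for w using M3(2)[of w] M1(1) M2(1) M3(1) by linarith
  qed (use M1(1) M2(1) M3(1) in linarith)
qed

lemma A_positive:
  obtains \<delta> where "\<delta> > 0" "\<And>s w. \<bar>s\<bar> < \<delta> \<Longrightarrow> A s w > 0"
proof -
  obtain M where M: "M > 0" "\<And>w. \<bar>A1 w\<bar> \<le> M" "\<And>w. \<bar>A2 w\<bar> \<le> M" "\<And>w. \<bar>A3 w\<bar> \<le> M"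
    using coeff_bound by blast
  show thesis
  \<comment> \<open>For \<open>\<bar>s\<bar> \<le> 1\<close> every higher power is at most
    \<open>\<bar>s\<bar>\<close>, so each of the three corrections to the leading 1 stays below
    1/3.\<close>
  proof (rule that[of "min 1 (1 / (3 * M))"])
    show "min 1 (1 / (3 * M)) > 0" using M(1) by simp
    fix s w assume s: "\<bar>s\<bar> < min 1 (1 / (3 * M))"
    then have sM: "\<bar>s\<bar> * M < 1 / 3" "\<bar>s\<bar> \<le> 1" using M(1) by (auto simp: field_simps)
    have "\<bar>s ^ n * x\<bar> \<le> \<bar>s\<bar> * M" if "n > 0" "\<bar>x\<bar> \<le> M" for n x
    proof -
      have "\<bar>s\<bar> ^ n \<le> \<bar>s\<bar> ^ 1" using that(1) sM(2) by (intro power_decreasing) auto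
      then show ?thesis unfolding abs_mult power_abs using that(2) by (intro mult_mono) auto
    qed
    from this[of 1 "A1 w"] this[of 2 "A2 w"] this[of 3 "A3 w"] M(2-4)
    have "\<bar>s * A1 w\<bar> \<le> \<bar>s\<bar> * M" "\<bar>s\<^sup>2 * A2 w\<bar> \<le> \<bar>s\<bar> * M" "\<bar>s ^ 3 * A3 w\<bar> \<le> \<bar>s\<bar> * M" by auto
    then show "A s w > 0" using sM(1) unfolding A_expand by linarith
  qed
qed

text \<open>The factor \<open>w$1 / 2\<close> does not depend on the second coordinate and can be
  moved under \<open>pd 2\<close>, which exhibits \<open>A1\<close> as a sum of partial derivatives
  of compactly supported functions.\<close>

lemma integral_A1: "integral UNIV A1 = 0"
proof -
  define u where "u w = (1/2) * w$1" for w :: "real^2"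
  have u: "(u has_derivative (\<lambda>v. (1/2) * v$1)) (at w)" for w
    unfolding u_def
    by (intro has_derivative_mult_right bounded_linear_imp_has_derivative bounded_linear_vec_nth)
  have C1u: "C1_on UNIV u"
    unfolding u_def
    by (intro C1_on_mult C1_on_const C1_on_bounded_linear[OF bounded_linear_vec_nth])
  have "pd 2 (\<lambda>w. u w * f w) w = w$1 / 2 * pd 2 f w" for w
    unfolding pd_mult[OF C1u C1(1)] pd_eq[OF u] by (simp add: axis_def u_def)
  then have A1_eq: "A1 = (\<lambda>w. (pd 1 h w + pd 2 m w) + pd 2 (\<lambda>w. u w * f w) w)"
    by (auto simp: A1_def)
  have uf: "C1_on UNIV (\<lambda>w. u w * f w)" by (rule C1_on_mult[OF C1u C1(1)])
  have uf0: "u w * f w = 0" if "w \<notin> C" for w using outside_C that by simp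
  have int: "pd i g integrable_on UNIV" if "C1_on UNIV g" "\<And>w. w \<notin> C \<Longrightarrow> g w = 0" for i g
    by (rule integrable_UNIV_compact_support[OF compact_C])
       (use pd_eq_0[OF compact_imp_closed[OF compact_C] that(2)] C1_on_continuous_pd[OF that(1)] in auto)
  show ?thesis
    unfolding A1_eq
    using integral_pd_zero[OF C1(2) compact_C outside_C(2)] integral_pd_zero[OF C1(3) compact_C outside_C(3)]
      integral_pd_zero[OF uf compact_C uf0]
    by (subst integral_add; (subst integral_add)?)
      (simp_all add: integrable_add int[OF C1(2) outside_C(2)] int[OF C1(3) outside_C(3)] int[OF uf uf0])
qed

lemma integrable_outside_C:
  "g integrable_on UNIV" if "continuous_on UNIV g" "\<And>w. w \<notin> C \<Longrightarrow> g w = 0" for g :: "real^2 \<Rightarrow> real"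
  using integrable_UNIV_compact_support[OF compact_C that(2,1)] by blast

text \<open>With \<open>u = w$1 / 2\<close>, the extra term \<open>h / 2 * pd 2 f\<close> is
  precisely what the product rule contributes to \<open>pd 1 (u * h)\<close>. Hence
  \<open>A2\<close> is the Jacobian of \<open>(h, m)\<close> plus that of
  \<open>(u * h, f)\<close>.\<close>

lemma integral_A2: "integral UNIV A2 = 0"
proof -
  define u where "u w = (1/2) * w$1" for w :: "real^2"
  have u: "(u has_derivative (\<lambda>v. (1/2) * v$1)) (at w)" for w
    unfolding u_def
    by (intro has_derivative_mult_right bounded_linear_imp_has_derivative bounded_linear_vec_nth)
  have C1u: "C1_on UNIV u"
    unfolding u_def
    by (intro C1_on_mult C1_on_const C1_on_bounded_linear[OF bounded_linear_vec_nth])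
  have uh: "C1_on UNIV (\<lambda>w. u w * h w)" by (rule C1_on_mult[OF C1u C1(2)])
  have uh0: "u w * h w = 0" if "w \<notin> C" for w using outside_C that by simp
  let ?J1 = "\<lambda>w. pd 1 h w * pd 2 m w - pd 2 h w * pd 1 m w"
  let ?J2 = "\<lambda>w. pd 1 (\<lambda>w. u w * h w) w * pd 2 f w - pd 2 (\<lambda>w. u w * h w) w * pd 1 f w"
  have A2_eq: "A2 = (\<lambda>w. ?J1 w + ?J2 w)"
    unfolding pd_mult[OF C1u C1(2)] pd_eq[OF u]
    by (auto simp: A2_def axis_def u_def field_simps)
  have "?J1 integrable_on UNIV" "?J2 integrable_on UNIV"
    by (rule integrable_outside_C; auto simp: pd_outside_C intro!: continuous_intros C1_on_continuous_pd C1 uh)+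
  then show ?thesis
    unfolding A2_eq
    using integral_Jacobian_zero[OF C1(2,3) compact_C outside_C(2,3)]
      integral_Jacobian_zero[OF uh C1(1) compact_C uh0 outside_C(1)]
    by (simp add: integral_add)
qed

section \<open>Differentiation under the integral sign\<close>

lemma continuous_pair:
  "continuous_on S (\<lambda>(s, w). A s w)" "continuous_on S (\<lambda>(s, w). B s w)"
  "continuous_on S (\<lambda>(s, w). A' s w)" "continuous_on S (\<lambda>(s, w). B' s w)"
  "continuous_on S (\<lambda>(s, w). A'' s w)" "continuous_on S (\<lambda>(s, w). B'' s w)"
  unfolding A_expand B_expand A'_def A''_def B'_def B''_def split_beta
  by (intro continuous_intros continuous_on_compose2[OF continuous_coeff(1)[of UNIV]]
      continuous_on_compose2[OF continuous_coeff(2)[of UNIV]] continuous_on_compose2[OF continuous_coeff(3)[of UNIV]]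
      continuous_on_compose2[OF continuous_coeff(4)[of UNIV]] continuous_on_compose2[OF continuous_coeff(5)[of UNIV]]
      continuous_on_compose2[OF continuous_coeff(6)[of UNIV]]; simp)+

lemma continuous_L: "continuous_on S (\<lambda>(s, w). L s w)"
  using continuous_pair(1,2)[of S] unfolding L_def split_beta by (intro continuous_intros)

lemma L_pos_nonzero: "A s w > 0 \<Longrightarrow> sqrt ((A s w)\<^sup>2 + (B s w)\<^sup>2) \<noteq> 0" "A s w > 0 \<Longrightarrow> (A s w)\<^sup>2 + (B s w)\<^sup>2 \<noteq> 0"
  by (auto simp: sum_power2_eq_zero_iff)

lemma continuous_L'_L'':
  assumes "\<And>s w. (s, w) \<in> S \<Longrightarrow> A s w > 0"
  shows "continuous_on S (\<lambda>(s, w). L' s w)" "continuous_on S (\<lambda>(s, w). L'' s w)"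
  using continuous_pair[of S] assms L_pos_nonzero unfolding L'_def L''_def split_beta
  by (intro continuous_intros; force)+

lemma L_outside_C: "w \<notin> C \<Longrightarrow> L s w = 1"
  by (simp add: L_def A_expand B_expand coeff_outside_C)

text \<open>Subtracting 1 from \<open>L\<close> confines the integration to a fixed box, where the
  Leibniz rule applies twice. The first derivative is needed on a whole interval, the second only at
  0, where \<open>A = 1\<close> and \<open>B = 0\<close> make both integrands explicit.\<close>

lemma second_derivative:
  assumes pos: "\<And>s w. \<bar>s\<bar> < \<delta> \<Longrightarrow> A s w > 0" and "\<delta> > 0" and pq: "C \<subseteq> cbox p q"
  shows "\<bar>s\<bar> < \<delta> \<Longrightarrow> ((\<lambda>s. integral (cbox p q) (\<lambda>w. L s w - 1)) has_real_derivative integral (cbox p q) (L' s)) (at s)"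
    and "((\<lambda>s. integral (cbox p q) (L' s)) has_real_derivative integral UNIV (\<lambda>w. (B1 w)\<^sup>2)) (at 0)"
    and "integral (cbox p q) (L' 0) = 0"
proof -
  let ?U = "{-\<delta><..<\<delta>}"
  have out: "w \<notin> C" if "w \<notin> cbox p q" for w using pq that by blast
  have pos': "A s w > 0" if "s \<in> ?U" for s w using pos that by (auto simp: abs_less_iff)
  have within: "at s within ?U = at s" if "s \<in> ?U" for s :: real
    using that by (intro at_within_open) auto
  have slice: "continuous_on (cbox p q) (G s)" if "continuous_on (?U \<times> cbox p q) (\<lambda>(s, w). G s w)" "s \<in> ?U"
    for G :: "real \<Rightarrow> real^2 \<Rightarrow> real" and s
    using continuous_on_compose2[OF that(1), of "cbox p q" "\<lambda>w. (s, w)"] that(2)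
    by (force intro: continuous_intros)
  have contL': "continuous_on (?U \<times> cbox p q) (\<lambda>(s, w). L' s w)"
    and contL'': "continuous_on (?U \<times> cbox p q) (\<lambda>(s, w). L'' s w)"
    by (rule continuous_L'_L''; use pos' in auto)+
  show "((\<lambda>s. integral (cbox p q) (\<lambda>w. L s w - 1)) has_real_derivative integral (cbox p q) (L' s)) (at s)"
    if "\<bar>s\<bar> < \<delta>"
  proof -
    have s: "s \<in> ?U" using that by auto
    have "((\<lambda>s. integral (cbox p q) (\<lambda>w. L s w - 1)) has_real_derivative integral (cbox p q) (L' s)) (at s within ?U)"
    proof (rule leibniz_rule_field_derivative[OF _ _ contL' s])
      show "((\<lambda>s. L s w - 1) has_real_derivative L' s w) (at s within ?U)" if "s \<in> ?U" for s w
        using DERIV_diff[OF DERIV_L(1)[OF pos'[OF that]] DERIV_const] by simp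
      show "(\<lambda>w. L s w - 1) integrable_on cbox p q" if "s \<in> ?U" for s
        by (intro integrable_continuous continuous_intros slice[OF continuous_L that])
    qed simp
    then show ?thesis unfolding within[OF s] .
  qed
  have 0: "(0::real) \<in> ?U" using \<open>\<delta> > 0\<close> by simp
  have "((\<lambda>s. integral (cbox p q) (L' s)) has_real_derivative integral (cbox p q) (L'' 0)) (at 0 within ?U)"
  proof (rule leibniz_rule_field_derivative[OF _ _ contL'' 0])
    show "((\<lambda>s. L' s w) has_real_derivative L'' s w) (at s within ?U)" if "s \<in> ?U" for s w
      by (rule DERIV_L(2)[OF pos'[OF that]])
    show "L' s integrable_on cbox p q" if "s \<in> ?U" for s
      by (intro integrable_continuous slice[OF contL' that])
  qed simp
  moreover have "integral (cbox p q) (L'' 0) = integral UNIV (\<lambda>w. (B1 w)\<^sup>2)"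
  proof -
    \<comment> \<open>The numerator contributes \<open>A1\<close> squared and the quotient rule
      subtracts it again, so only \<open>2 * A2\<close> and the square of \<open>B1\<close>
      survive.\<close>
    have L''0: "L'' 0 = (\<lambda>w. 2 * A2 w + (B1 w)\<^sup>2)"
      by (auto simp: L''_def A_expand B_expand A'_def B'_def A''_def B''_def power2_eq_square)
    have "integral (cbox p q) (L'' 0) = integral UNIV (L'' 0)"
      by (rule integral_cbox_eq_UNIV) (simp add: L''0 coeff_outside_C[OF out])
    also have "\<dots> = 2 * integral UNIV A2 + integral UNIV (\<lambda>w. (B1 w)\<^sup>2)"
      unfolding L''0
      by (subst integral_add)
         (auto intro!: integrable_outside_C continuous_intros continuous_coeff simp: coeff_outside_C)
    finally show ?thesis by (simp add: integral_A2)
  qed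
  ultimately show "((\<lambda>s. integral (cbox p q) (L' s)) has_real_derivative integral UNIV (\<lambda>w. (B1 w)\<^sup>2)) (at 0)"
    unfolding within[OF 0] by simp
  have L'0: "L' 0 = A1"
    by (auto simp: L'_def A_expand B_expand A'_def B'_def)
  have "integral (cbox p q) A1 = integral UNIV A1"
    by (rule integral_cbox_eq_UNIV) (simp add: coeff_outside_C[OF out])
  then show "integral (cbox p q) (L' 0) = 0" by (simp add: L'0 integral_A1)
qed

text \<open>\<open>L\<close> equals 1 off \<open>C\<close>, so \<open>L - 1\<close> has the same
  integral over \<open>E\<close> as over the box. The portion \<open>E\<close> enters only through
  its area, a constant in \<open>s\<close>.\<close>

lemma perimeter_eq_integral:
  assumes "C \<subseteq> cbox p q" and E: "compact E" "C \<subseteq> E"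
    and em: "emeasure (H_perimeter_measure (range (\<psi> s))) (\<psi> s ` E) = (\<integral>\<^sup>+w\<in>E. ennreal (L s w) \<partial>lborel)"
  shows "measure (H_perimeter_measure (range (\<psi> s))) (\<psi> s ` E)
    = measure lborel E + integral (cbox p q) (\<lambda>w. L s w - 1)"
proof -
  let ?I = "integral (cbox p q) (\<lambda>w. L s w - 1)"
  have out: "w \<notin> C" if "w \<notin> cbox p q" for w using assms(1) that by blast
  have "continuous_on UNIV (\<lambda>w. L s w)"
    using continuous_on_compose2[OF continuous_L[of UNIV], of UNIV "\<lambda>w. (s, w)"]
    by (simp add: continuous_on_Pair)
  then have "(\<lambda>w. L s w - 1) integrable_on UNIV"
    by (intro integrable_outside_C continuous_intros) (auto simp: L_outside_C)
  then have "((\<lambda>w. L s w - 1) has_integral ?I) UNIV"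
    using integral_cbox_eq_UNIV[of p q "\<lambda>w. L s w - 1"] L_outside_C[OF out]
    by (simp add: has_integral_iff)
  moreover have "(\<lambda>w. if w \<in> E then L s w - 1 else 0) = (\<lambda>w. L s w - 1)"
  proof
    fix w
    show "(if w \<in> E then L s w - 1 else 0) = L s w - 1"
      using E(2) L_outside_C[of w s] by (cases "w \<in> C") auto
  qed
  ultimately have "((\<lambda>w. L s w - 1) has_integral ?I) E"
    using has_integral_restrict_UNIV[of E "\<lambda>w. L s w - 1" ?I] by simp
  moreover have "((\<lambda>w. 1) has_integral measure lborel E) E"
    using emeasure_bounded_finite[OF compact_imp_bounded[OF E(1)]] borel_compact[OF E(1)]
    by (intro has_integral_measure_lborel) auto
  ultimately have "((\<lambda>w. 1 + (L s w - 1)) has_integral (measure lborel E + ?I)) E"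
    by (intro has_integral_add)
  then have int: "(L s has_integral (measure lborel E + ?I)) E" by simp
  have nn: "0 \<le> L s w" for w by (simp add: L_def)
  have "emeasure (H_perimeter_measure (range (\<psi> s))) (\<psi> s ` E) = ennreal (measure lborel E + ?I)"
    unfolding em using nn_integral_has_integral_lebesgue'[OF _ int] nn by simp
  moreover have "0 \<le> measure lborel E + ?I"
    using has_integral_nonneg[OF int] nn by simp
  ultimately show ?thesis by (simp add: measure_def)
qed

text \<open>\<open>P'\<close> and \<open>v\<close> are produced before \<open>E\<close>, since a
  variation must have the same value for every compact portion. Only the perimeter itself depends on
  \<open>E\<close>.\<close>

lemma perimeter_derivatives:
  obtains P' v where "v \<ge> 0" "P' 0 = 0" "(P' has_real_derivative v) (at 0)"
    and "\<And>E. compact E \<Longrightarrow> C \<subseteq> E \<Longrightarrow> \<forall>\<^sub>F s in nhds 0.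
      ((\<lambda>s. measure (H_perimeter_measure (range (\<psi> s))) (\<psi> s ` E)) has_real_derivative P' s) (at s)"
proof -
  obtain p q where pq: "C \<subseteq> cbox p q"
    using bounded_subset_cbox_symmetric[OF compact_imp_bounded[OF compact_C]] by blast
  obtain \<delta> where \<delta>: "\<delta> > 0" "\<And>s w. \<bar>s\<bar> < \<delta> \<Longrightarrow> A s w > 0" using A_positive by blast
  obtain \<epsilon> where \<epsilon>: "\<epsilon> > 0" "\<And>s E. \<bar>s\<bar> < \<epsilon> \<Longrightarrow> E \<in> sets borel \<Longrightarrow>
      emeasure (H_perimeter_measure (range (\<psi> s))) (\<psi> s ` E) = (\<integral>\<^sup>+w\<in>E. ennreal (L s w) \<partial>lborel)"
    using perimeter_formula unfolding L_def by blast
  note der = second_derivative[OF \<delta>(2) \<delta>(1) pq]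
  show thesis
  proof (rule that[of "integral UNIV (\<lambda>w. (B1 w)\<^sup>2)" "\<lambda>s. integral (cbox p q) (L' s)"])
    show "0 \<le> integral UNIV (\<lambda>w. (B1 w)\<^sup>2)"
      by (intro integral_nonneg integrable_outside_C continuous_intros continuous_coeff)
         (auto simp: coeff_outside_C)
    fix E assume E: "compact E" "C \<subseteq> E"
    let ?r = "min \<delta> \<epsilon>"
    have eq: "measure (H_perimeter_measure (range (\<psi> s))) (\<psi> s ` E)
        = measure lborel E + integral (cbox p q) (\<lambda>w. L s w - 1)" if "s \<in> {-?r<..<?r}" for s
      using that E by (intro perimeter_eq_integral[OF pq E] \<epsilon>(2)) (auto simp: borel_compact)
    have "((\<lambda>s. measure (H_perimeter_measure (range (\<psi> s))) (\<psi> s ` E)) has_real_derivative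
        integral (cbox p q) (L' s)) (at s)" if s: "s \<in> {-?r<..<?r}" for s
    proof -
      have "((\<lambda>s. measure lborel E + integral (cbox p q) (\<lambda>w. L s w - 1)) has_real_derivative
          integral (cbox p q) (L' s)) (at s)"
        using DERIV_add[OF DERIV_const der(1)[of s]] s by auto
      then show ?thesis
        by (rule has_field_derivative_transform_within_open[OF _ open_greaterThanLessThan s])
           (simp add: eq)
    qed
    moreover have "\<forall>\<^sub>F s in nhds (0::real). s \<in> {-?r<..<?r}"
      using \<delta>(1) \<epsilon>(1) by (intro eventually_nhds_in_open) auto
    ultimately show "\<forall>\<^sub>F s in nhds 0. ((\<lambda>s. measure (H_perimeter_measure (range (\<psi> s))) (\<psi> s ` E)) has_real_derivative
        integral (cbox p q) (L' s)) (at s)"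
      by (auto elim: eventually_mono)
  qed (use der in auto)
qed

end

section \<open>Vertical planes\<close>

context
  fixes a b \<gamma> :: real
  assumes unit: "a\<^sup>2 + b\<^sup>2 = 1"
begin

definition plane_coords :: "real^3 \<Rightarrow> real^2" where
  "plane_coords g = vec2 (a * g$2 - b * g$1) (g$3)"

definition plane_point :: "real^2 \<Rightarrow> real^3" where
  "plane_point w = frame a b \<gamma> (w$1) (w$2)"

lemma unit_mult: "a * (a * x) + b * (b * x) = x"
proof -
  have "a * (a * x) + b * (b * x) = (a\<^sup>2 + b\<^sup>2) * x" by (simp add: algebra_simps power2_eq_square)
  then show ?thesis using unit by simp
qed

lemma plane_coords_point [simp]: "plane_coords (plane_point w) = w"
  using unit_mult[of "w$1"]
  by (simp add: plane_coords_def plane_point_def vec2_eq_iff algebra_simps)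

lemma plane_point_in: "plane_point w \<in> vertical_plane a b \<gamma>"
  using unit_mult[of \<gamma>]
  by (simp add: plane_point_def vertical_plane_def algebra_simps)

lemma plane_point_coords: "g \<in> vertical_plane a b \<gamma> \<Longrightarrow> plane_point (plane_coords g) = g"
  using unit_mult[of "g$1"] unit_mult[of "g$2"]
  by (auto simp: plane_point_def plane_coords_def vertical_plane_def vec3_eq_iff algebra_simps)

lemma range_plane_point: "range plane_point = vertical_plane a b \<gamma>"
  using plane_point_in plane_point_coords by (metis image_subset_iff rangeI subsetI subset_antisym)

lemma continuous_plane_coords: "continuous_on A plane_coords"
  unfolding plane_coords_def vec2_def by (intro continuous_intros)

lemma C2_plane_point: "C2_on U plane_point"
  unfolding plane_point_def frame_def add.assoc
  by (intro C2_on_add[OF C2_on_const C2_on_bounded_linear] bounded_linear_add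
      bounded_linear_scaleR_left[THEN bounded_linear_compose] bounded_linear_vec_nth)

text \<open>A C2 function on the plane has C2 extensions only near each point. Composition with the
  affine \<open>plane_point\<close> sees no difference between function and extension, and being C2
  is a local property.\<close>

lemma C2_on_compose_plane_point:
  assumes "C2_function_on_surface (vertical_plane a b \<gamma>) u"
  shows "C2_on UNIV (\<lambda>w. u (plane_point w))"
proof (rule C2_on_local)
  fix w
  obtain U F where U: "open U" "plane_point w \<in> U" "C2_on U F" "\<And>p. p \<in> vertical_plane a b \<gamma> \<inter> U \<Longrightarrow> F p = u p"
    using assms plane_point_in unfolding C2_function_on_surface_def by meson
  let ?V = "plane_point -` U"
  have V: "open ?V"
    using U(1) C1_on_imp_continuous_on[OF C2_on_imp_C1_on[OF C2_plane_point]] by (simp add: open_vimage)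
  have "C2_on ?V (\<lambda>w. F (plane_point w))"
    by (rule C2_on_compose[OF C2_plane_point U(3)]) auto
  then have "C2_on ?V (\<lambda>w. u (plane_point w))"
    by (rule C2_on_cong_open[OF _ V]) (simp add: U(4) plane_point_in)
  with V U(2) show "\<exists>V. open V \<and> w \<in> V \<and> C2_on V (\<lambda>w. u (plane_point w))" by blast
qed

lemma plane_defining_function:
  "defining_function (vertical_plane a b \<gamma>) UNIV (\<lambda>g. (a * g$1 + b * g$2) + (- \<gamma>))"
proof -
  let ?\<phi> = "\<lambda>g :: real^3. (a * g$1 + b * g$2) + (- \<gamma>)"
  have lin: "bounded_linear (\<lambda>g :: real^3. a * g$1 + b * g$2)"
    by (intro bounded_linear_intros bounded_linear_vec_nth)
  have der: "(?\<phi> has_derivative (\<lambda>v. a * v$1 + b * v$2)) (at g)" for g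
    using has_derivative_add[OF bounded_linear_imp_has_derivative[OF lin] has_derivative_const[of "- \<gamma>"]]
    by simp
  have "euclid_grad ?\<phi> g \<noteq> 0" for g
  proof
    assume "euclid_grad ?\<phi> g = 0"
    then have "euclid_grad ?\<phi> g $ 1 = 0" "euclid_grad ?\<phi> g $ 2 = 0" by simp_all
    then have "a = 0" "b = 0"
      unfolding euclid_grad_def frechet_derivative_at[OF der, symmetric] by (simp_all add: axis_def)
    then show False using unit by simp
  qed
  moreover have "C2_on UNIV ?\<phi>"
    by (intro C2_on_add C2_on_const C2_on_bounded_linear lin)
  ultimately show ?thesis
    by (auto simp: defining_function_def vertical_plane_def)
qed

text \<open>The line through \<open>g\<close> in direction \<open>T\<close> stays in the plane, so
  \<open>T g\<close> is tangent. It is not horizontal: its first two components vanish, which forces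
  both coefficients of \<open>X1 g\<close> and \<open>X2 g\<close> to be 0.\<close>

lemma plane_characteristic_locus: "characteristic_locus (vertical_plane a b \<gamma>) = {}"
proof -
  have "tangent_space (vertical_plane a b \<gamma>) g \<noteq> span {X1 g, X2 g}" if g: "g \<in> vertical_plane a b \<gamma>" for g
  proof
    assume eq: "tangent_space (vertical_plane a b \<gamma>) g = span {X1 g, X2 g}"
    let ?c = "\<lambda>s. g + s *\<^sub>R T g"
    have "(?c has_vector_derivative T g) (at s)" for s
      by (auto intro!: derivative_eq_intros)
    moreover have "?c C1_differentiable_on {-1<..<1}"
      by (intro C1_differentiable_on_add C1_differentiable_on_scaleR) (auto simp: C1_differentiable_on_def)
    moreover have "?c s \<in> vertical_plane a b \<gamma>" for s
      using g by (simp add: vertical_plane_def T_def)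
    ultimately have "T g \<in> tangent_space (vertical_plane a b \<gamma>) g"
      unfolding tangent_space_def by (intro CollectI exI[of _ ?c] exI[of _ 1]) auto
    then obtain x y where "T g = x *\<^sub>R X1 g + y *\<^sub>R X2 g"
      unfolding eq span_insert span_empty by (auto simp: algebra_simps)
    then show False by (auto simp: vec3_eq_iff T_def X1_def X2_def)
  qed
  then show ?thesis unfolding characteristic_locus_def by blast
qed

lemma plane_variations:
  assumes C2: "C2_compact_support (vertical_plane a b \<gamma>) u" "C2_compact_support (vertical_plane a b \<gamma>) v"
    "C2_compact_support (vertical_plane a b \<gamma>) k"
  shows "has_first_variation (vertical_plane a b \<gamma>) u v k 0"
    and "\<exists>c\<ge>0. has_second_variation (vertical_plane a b \<gamma>) u v k c"
proof -
  let ?S = "vertical_plane a b \<gamma>"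
  define C where "C = plane_coords ` (supp ?S u \<union> supp ?S v \<union> supp ?S k)"
  \<comment> \<open>\<open>f\<close> and \<open>h\<close> are the components of the horizontal
    coefficients \<open>(u, v)\<close> along the unit normal and along the horizontal tangent
    direction.\<close>
  define f where "f w = a * u (plane_point w) + b * v (plane_point w)" for w
  define h where "h w = (- b) * u (plane_point w) + a * v (plane_point w)" for w
  \<comment> \<open>The t-component of \<open>u X1 + v X2 + k T\<close>, including the contributions
    of the two horizontal fields.\<close>
  define m where "m w = k (plane_point w) + (1/2 * plane_point w $ 1 * v (plane_point w)
      + (- 1/2) * plane_point w $ 2 * u (plane_point w))" for w
  have supp: "q (plane_point w) = 0" if "w \<notin> plane_coords ` supp ?S q" for w q
  proof (rule ccontr)
    assume "q (plane_point w) \<noteq> 0"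
    then have "plane_point w \<in> {g \<in> ?S. q g \<noteq> 0}" using plane_point_in by simp
    from subsetD[OF closure_subset this] have "plane_point w \<in> supp ?S q"
      using plane_point_in unfolding supp_def by blast
    with that show False by (metis imageI plane_coords_point)
  qed
  have out: "u (plane_point w) = 0" "v (plane_point w) = 0" "k (plane_point w) = 0" if "w \<notin> C" for w
    using that supp[of w u] supp[of w v] supp[of w k] unfolding C_def by (auto simp: image_Un)
  have C2': "C2_on UNIV (\<lambda>w. u (plane_point w))" "C2_on UNIV (\<lambda>w. v (plane_point w))" "C2_on UNIV (\<lambda>w. k (plane_point w))"
    using C2 C2_on_compose_plane_point unfolding C2_compact_support_def by blast+
  have C2_nth: "C2_on UNIV (\<lambda>w. plane_point w $ i)" for i
    by (rule C2_on_compose[OF C2_plane_point C2_on_bounded_linear[OF bounded_linear_vec_nth, of UNIV]]) auto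
  interpret V: plane_variation a b \<gamma> f h m C
  proof
    show "C2_on UNIV f" "C2_on UNIV h" "C2_on UNIV m"
      unfolding f_def h_def m_def by (intro C2_on_add C2_on_mult C2_on_const C2' C2_nth)+
    show "compact C"
      unfolding C_def using C2
      by (intro compact_continuous_image continuous_plane_coords compact_Un) (auto simp: C2_compact_support_def)
  qed (use unit out in \<open>auto simp: f_def h_def m_def\<close>)
  have \<psi>: "V.\<psi> s w = deform u v k s (plane_point w)" for s w
  proof -
    have fh: "a * f w - b * h w = u (plane_point w)" "b * f w + a * h w = v (plane_point w)"
      using unit_mult[of "u (plane_point w)"] unit_mult[of "v (plane_point w)"]
      by (simp_all add: f_def h_def algebra_simps)
    have "a * (\<gamma> + s * f w) - b * (w$1 + s * h w) = (a * \<gamma> - b * w$1) + s * u (plane_point w)"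
      "b * (\<gamma> + s * f w) + a * (w$1 + s * h w) = (b * \<gamma> + a * w$1) + s * v (plane_point w)"
      unfolding fh[symmetric] by (simp_all add: algebra_simps)
    moreover have "w$2 + s * m w = w$2 + s * (u (plane_point w) * (- (plane_point w $ 2) / 2)
        + v (plane_point w) * (plane_point w $ 1 / 2) + k (plane_point w))"
      by (simp add: m_def mult.commute)
    ultimately show ?thesis
      by (simp add: vec3_eq_iff V.\<psi>_def deform_def X1_def X2_def T_def plane_point_def)
  qed
  have surf: "deform u v k s ` ?S = range (V.\<psi> s)" for s
    unfolding range_plane_point[symmetric] by (simp add: \<psi> image_image)
  have per: "perimeter_along ?S u v k K = (\<lambda>s. measure (H_perimeter_measure (range (V.\<psi> s))) (V.\<psi> s ` (plane_coords ` K)))"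
    if "K \<subseteq> ?S" for K
  proof
    fix s
    have "V.\<psi> s ` (plane_coords ` K) = deform u v k s ` K"
      unfolding image_image \<psi> using that plane_point_coords by (intro image_cong) auto
    then show "perimeter_along ?S u v k K s = measure (H_perimeter_measure (range (V.\<psi> s))) (V.\<psi> s ` (plane_coords ` K))"
      by (simp add: perimeter_along_def surf)
  qed
  obtain P' c where P': "c \<ge> 0" "P' 0 = 0" "(P' has_real_derivative c) (at 0)"
    "\<And>E. compact E \<Longrightarrow> C \<subseteq> E \<Longrightarrow> \<forall>\<^sub>F s in nhds 0.
      ((\<lambda>s. measure (H_perimeter_measure (range (V.\<psi> s))) (V.\<psi> s ` E)) has_real_derivative P' s) (at s)"
    by (rule V.perimeter_derivatives) blast
  have ev: "\<forall>\<^sub>F s in nhds 0. (perimeter_along ?S u v k K has_real_derivative P' s) (at s)"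
    if "compact_portion ?S u v k K" for K
  proof -
    have K: "compact K" "K \<subseteq> ?S" "supp ?S u \<union> supp ?S v \<union> supp ?S k \<subseteq> K"
      using that unfolding compact_portion_def by auto
    have "compact (plane_coords ` K)"
      by (intro compact_continuous_image continuous_plane_coords K)
    moreover have "C \<subseteq> plane_coords ` K" unfolding C_def using K(3) by (rule image_mono)
    ultimately show ?thesis unfolding per[OF K(2)] by (rule P'(4))
  qed
  show "has_first_variation ?S u v k 0"
    unfolding has_first_variation_def
  proof (intro allI impI)
    fix K assume "compact_portion ?S u v k K"
    \<comment> \<open>\<open>nhds 0\<close> is the unpunctured filter, so the derivative is
      available at 0 itself, with value \<open>P' 0\<close>.\<close>
    from eventually_nhds_x_imp_x[OF ev[OF this]]
    show "(perimeter_along ?S u v k K has_real_derivative 0) (at 0)" unfolding P'(2) .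
  qed
  show "\<exists>c\<ge>0. has_second_variation ?S u v k c"
    unfolding has_second_variation_def using P'(1,3) ev by blast
qed

lemma stable_unit_vertical_plane: "stable (vertical_plane a b \<gamma>)"
  unfolding stable_def stationary_def C2_surface_def
  using plane_defining_function plane_characteristic_locus plane_variations by blast

end

theorem theorem3p5:
  fixes a b \<gamma> :: real
  assumes "(a, b) \<noteq> (0, 0)"
  shows "stable (vertical_plane a b \<gamma>)"
proof -
  \<comment> \<open>Dividing the equation by the length of \<open>(a, b)\<close> leaves the set
    unchanged and gives a unit normal.\<close>
  define r where "r = sqrt (a\<^sup>2 + b\<^sup>2)"
  have pos: "a\<^sup>2 + b\<^sup>2 > 0" using assms by (simp add: sum_power2_gt_zero_iff)
  then have r: "r > 0" "r\<^sup>2 = a\<^sup>2 + b\<^sup>2" by (simp_all add: r_def)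
  have "(a / r)\<^sup>2 + (b / r)\<^sup>2 = (a\<^sup>2 + b\<^sup>2) / r\<^sup>2"
    by (simp add: power_divide add_divide_distrib)
  also have "\<dots> = 1" unfolding r(2)[symmetric] using r(1) by simp
  finally have "stable (vertical_plane (a / r) (b / r) (\<gamma> / r))" by (rule stable_unit_vertical_plane)
  moreover have "vertical_plane (a / r) (b / r) (\<gamma> / r) = vertical_plane a b \<gamma>"
    using r(1) by (auto simp: vertical_plane_def field_simps)
  ultimately show ?thesis by simp
qed

end
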